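(* The real scalar-identity ideal $\mathcal I_n^{\mathbb R}$ is generated, as a two-sided $*$-ideal in $\mathbb R\langle\mathbf q,\bar{\mathbf q}\rangle$, by the commutators $[w+w^*,q_i]$: $$\mathcal I_n^{\mathbb R}=\langle[w+w^*,q_i]:w\in\mathcal W,\ i=1,\dots,n\rangle_*.$$
   Context: $\mathbb H$ is the skew field of quaternions. Fix $n\ge1$ and letters $q_1,\dots,q_n,\bar q_1,\dots,\bar q_n$. $\mathcal W$ is the set of words (including the empty word $1$) in these letters, where words with the same normal form are identified: any consecutive factor $q_i\bar q_i$ or $\bar q_iq_i$ is written $|q_i|^2$ and moved to the front, so each word is uniquely $\prod_i|q_i|^{2\alpha_i}\tilde w$ with $\tilde w$ containing no such factor. $w^*$ is obtained by reversing $w$ and exchanging $q_i\leftrightarrow\bar q_i$. $\mathbb R\langle\mathbf q,\bar{\mathbf q}\rangle$ is the real $*$-algebra of finite sums $\sum_wp_ww$, $p_w\in\mathbb R$, with $p^*=\sum_wp_ww^*$. $[a,b]=ab-ba$ (the sign is immaterial for generated ideals). $\mathcal I_n^{\mathbb R}$ is the kernel of the unital $*$-homomorphism $\rho_{\mathbb R}:\mathbb R\langle\mathbf q,\bar{\mathbf q}\rangle\to\mathbb H[x_{11},\dots,x_{n4}]$ (commuting central real variables $x_{ij}$) with $\rho_{\mathbb R}(q_i)=x_{i1}+x_{i2}\mathbf i+x_{i3}\mathbf j+x_{i4}\mathbf k$ and $\rho_{\mathbb R}(\bar q_i)$ its conjugate; equivalently it consists of the polynomials $p$ that vanish under every evaluation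 $q_i\mapsto a_i$, $\bar q_i\mapsto\bar a_i$ with $(a_1,\dots,a_n)\in\mathbb H^n$. $\langle S\rangle_*$ is the two-sided $*$-ideal generated by $S$. *)

theory Defs
  imports Complex_Main "HOL-Library.Poly_Mapping" "HOL-Library.Numeral_Type"
begin

section \<open>The skew field of quaternions\<close>

datatype quat = Quat (qre: real) (qim1: real) (qim2: real) (qim3: real)

lemma quat_eq_iff:
  "a = b \<longleftrightarrow> qre a = qre b \<and> qim1 a = qim1 b \<and> qim2 a = qim2 b \<and> qim3 a = qim3 b"
  by (cases a; cases b) simp

instantiation quat :: division_ring
begin

definition "0 = Quat 0 0 0 0"
definition "1 = Quat 1 0 0 0"
definition "- a = Quat (- qre a) (- qim1 a) (- qim2 a) (- qim3 a)"
definition "a + b = Quat (qre a + qre b) (qim1 a + qim1 b) (qim2 a + qim2 b) (qim3 a + qim3 b)"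
definition "a - b = Quat (qre a - qre b) (qim1 a - qim1 b) (qim2 a - qim2 b) (qim3 a - qim3 b)"
definition "a * b = Quat
  (qre a * qre b - qim1 a * qim1 b - qim2 a * qim2 b - qim3 a * qim3 b)
  (qre a * qim1 b + qim1 a * qre b + qim2 a * qim3 b - qim3 a * qim2 b)
  (qre a * qim2 b - qim1 a * qim3 b + qim2 a * qre b + qim3 a * qim1 b)
  (qre a * qim3 b + qim1 a * qim2 b - qim2 a * qim1 b + qim3 a * qre b)"
definition "inverse a = (let N = (qre a)\<^sup>2 + (qim1 a)\<^sup>2 + (qim2 a)\<^sup>2 + (qim3 a)\<^sup>2
  in Quat (qre a / N) (- qim1 a / N) (- qim2 a / N) (- qim3 a / N))"
definition "a div b = a * inverse (b :: quat)"

lemmas quat_defs = zero_quat_def one_quat_def uminus_quat_def plus_quat_def minus_quat_def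
  times_quat_def

instance
proof
  fix a b c :: quat
  show "a * b * c = a * (b * c)" by (simp add: quat_defs algebra_simps)
  show "(a + b) * c = a * c + b * c" by (simp add: quat_defs algebra_simps)
  show "a * (b + c) = a * b + a * c" by (simp add: quat_defs algebra_simps)
  show "inverse (0 :: quat) = 0" by (simp add: quat_defs inverse_quat_def)
  show "a div b = a * inverse b" by (rule divide_quat_def)
  assume "a \<noteq> 0"
  define N where "N = (qre a)\<^sup>2 + (qim1 a)\<^sup>2 + (qim2 a)\<^sup>2 + (qim3 a)\<^sup>2"
  have "N \<noteq> 0"
    using \<open>a \<noteq> 0\<close> unfolding N_def
    by (auto simp: quat_eq_iff zero_quat_def add_nonneg_eq_0_iff)
  moreover have "inverse a = Quat (qre a / N) (- qim1 a / N) (- qim2 a / N) (- qim3 a / N)"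
    by (simp add: inverse_quat_def N_def Let_def)
  ultimately show "inverse a * a = 1" "a * inverse a = 1"
    by (simp_all add: quat_defs field_simps) (simp_all add: N_def power2_eq_square algebra_simps)
qed (simp_all add: quat_defs)

end

definition quat_of_real :: "real \<Rightarrow> quat" where "quat_of_real r = Quat r 0 0 0"
definition quat_i :: quat where "quat_i = Quat 0 1 0 0"
definition quat_j :: quat where "quat_j = Quat 0 0 1 0"
definition quat_k :: quat where "quat_k = Quat 0 0 0 1"

definition quat_cnj :: "quat \<Rightarrow> quat" where
  "quat_cnj a = Quat (qre a) (- qim1 a) (- qim2 a) (- qim3 a)"

lemma quat_cnj_simps [simp]:
  "quat_cnj 0 = 0" "quat_cnj 1 = 1" "quat_cnj (a + b) = quat_cnj a + quat_cnj b"
  "quat_cnj (a * b) = quat_cnj b * quat_cnj a"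
  "quat_cnj (quat_of_real r) = quat_of_real r"
  "quat_cnj (quat_cnj a) = a"
  by (simp_all add: quat_cnj_def quat_defs quat_of_real_def algebra_simps)

lemma quat_of_real_simps [simp]:
  "quat_of_real 0 = 0" "quat_of_real 1 = 1"
  "quat_of_real (r + s) = quat_of_real r + quat_of_real s"
  "quat_of_real (r * s) = quat_of_real r * quat_of_real s"
  by (simp_all add: quat_defs quat_of_real_def)

lemma quat_of_real_central: "quat_of_real r * a = a * quat_of_real r"
  by (simp add: quat_defs quat_of_real_def)


section \<open>Words in the letters \<open>q\<^sub>i\<close> and their conjugates\<close>

datatype 'n letter = Q 'n | Qbar 'n

fun bar :: "'n letter \<Rightarrow> 'n letter" where
  "bar (Q i) = Qbar i"
| "bar (Qbar i) = Q i"

fun idx :: "'n letter \<Rightarrow> 'n" where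
  "idx (Q i) = i"
| "idx (Qbar i) = i"

lemma bar_bar [simp]: "bar (bar l) = l" by (cases l) auto
lemma idx_bar [simp]: "idx (bar l) = idx l" by (cases l) auto

text \<open>
  The pair \<open>(\<alpha>, w)\<close> stands for the normal form \<open>\<Prod>\<^sub>i |q\<^sub>i|\<^bsup>2 \<alpha>\<^sub>i\<^esup> w\<close>.
\<close>

fun nf_cons :: "'n letter \<Rightarrow> ('n \<Rightarrow> nat) \<times> 'n letter list \<Rightarrow> ('n \<Rightarrow> nat) \<times> 'n letter list" where
  "nf_cons l (\<alpha>, []) = (\<alpha>, [l])"
| "nf_cons l (\<alpha>, m # w) =
     (if m = bar l then (\<alpha>(idx l := \<alpha> (idx l) + 1), w) else (\<alpha>, l # m # w))"

definition normal_form :: "'n letter list \<Rightarrow> ('n \<Rightarrow> nat) \<times> 'n letter list" where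
  "normal_form u = foldr nf_cons u (\<lambda>_. 0, [])"

definition same_nf :: "'n letter list \<Rightarrow> 'n letter list \<Rightarrow> bool" where
  "same_nf u v \<longleftrightarrow> normal_form u = normal_form v"

fun reduced :: "'n letter list \<Rightarrow> bool" where
  "reduced [] = True"
| "reduced [l] = True"
| "reduced (l # m # w) = (m \<noteq> bar l \<and> reduced (m # w))"

lemma reduced_nf_cons: "reduced (snd s) \<Longrightarrow> reduced (snd (nf_cons l s))"
proof (induction l s rule: nf_cons.induct)
  case (2 l \<alpha> m w)
  then show ?case by (cases w) auto
qed auto

lemma reduced_foldr_nf_cons: "reduced (snd s) \<Longrightarrow> reduced (snd (foldr nf_cons u s))"
  by (induction u) (auto intro: reduced_nf_cons)

lemma reduced_normal_form: "reduced (snd (normal_form u))"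
  unfolding normal_form_def by (rule reduced_foldr_nf_cons) simp

lemma nf_cons_bar:
  assumes "reduced (snd s)"
  shows "nf_cons l (nf_cons (bar l) s) = ((fst s)(idx l := fst s (idx l) + 1), snd s)"
proof (cases s)
  case (Pair \<alpha> w)
  show ?thesis
  proof (cases w)
    case Nil
    then show ?thesis using Pair by simp
  next
    case (Cons m v)
    show ?thesis
    proof (cases "m = l")
      case True
      then show ?thesis using Pair Cons assms by (cases v) auto
    next
      case False
      then show ?thesis using Pair Cons by auto
    qed
  qed
qed

lemma nf_cons_bump:
  "nf_cons l (\<alpha>(i := Suc (\<alpha> i)), w) =
     (let (\<beta>, v) = nf_cons l (\<alpha>, w) in (\<beta>(i := Suc (\<beta> i)), v))"
  by (cases w) (auto simp: fun_eq_iff)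

lemma foldr_nf_cons_bump:
  "foldr nf_cons u (\<alpha>(i := Suc (\<alpha> i)), w) =
     (let (\<beta>, v) = foldr nf_cons u (\<alpha>, w) in (\<beta>(i := Suc (\<beta> i)), v))"
  by (induction u) (auto simp: nf_cons_bump simp del: fun_upd_apply split: prod.splits)

lemma normal_form_move:
  "normal_form (u @ [l, bar l] @ v) =
     (let (\<alpha>, w) = normal_form (u @ v) in (\<alpha>(idx l := \<alpha> (idx l) + 1), w))"
proof -
  obtain \<alpha> w where s: "normal_form v = (\<alpha>, w)" by (cases "normal_form v")
  then have "reduced w" using reduced_normal_form[of v] by simp
  then show ?thesis using s
    by (simp add: normal_form_def nf_cons_bar foldr_nf_cons_bump del: fun_upd_apply)
qed

text \<open>
  Two words have the same normal form iff they are related by the equivalence that moves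
  factors \<open>|q\<^sub>i|\<^sup>2\<close> to the front (lemma \<open>same_nf_iff\<close>). Hence concatenation, the involution and
  evaluation descend to the quotient.
\<close>

inductive word_eq :: "'n letter list \<Rightarrow> 'n letter list \<Rightarrow> bool" where
  refl: "word_eq u u"
| sym: "word_eq u v \<Longrightarrow> word_eq v u"
| trans: "word_eq u v \<Longrightarrow> word_eq v w \<Longrightarrow> word_eq u w"
| move: "word_eq (u @ [l, bar l] @ v) ([Q (idx l), Qbar (idx l)] @ u @ v)"

lemma word_eq_imp_same_nf: "word_eq u v \<Longrightarrow> same_nf u v"
proof (induction rule: word_eq.induct)
  case (move u l v)
  have "normal_form ([Q (idx l), Qbar (idx l)] @ u @ v) =
      (let (\<alpha>, w) = normal_form (u @ v) in (\<alpha>(idx l := \<alpha> (idx l) + 1), w))"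
    using normal_form_move[of "[]" "Q (idx l)" "u @ v"] by simp
  then show ?case using normal_form_move[of u l v] by (simp add: same_nf_def)
qed (auto simp: same_nf_def)

lemma word_eq_append: "word_eq u v \<Longrightarrow> word_eq (x @ u @ y) (x @ v @ y)"
proof (induction rule: word_eq.induct)
  case (move u l v)
  have "word_eq ((x @ u) @ [l, bar l] @ (v @ y)) ([Q (idx l), Qbar (idx l)] @ (x @ u) @ (v @ y))"
    by (rule word_eq.move)
  moreover have "word_eq (x @ [Q (idx l), bar (Q (idx l))] @ (u @ v @ y))
      ([Q (idx (Q (idx l))), Qbar (idx (Q (idx l)))] @ x @ (u @ v @ y))"
    by (rule word_eq.move)
  ultimately show ?case
    using word_eq.sym word_eq.trans by fastforce
qed (auto intro: word_eq.intros)

definition squares :: "'n list \<Rightarrow> 'n letter list" where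
  "squares us = concat (map (\<lambda>i. [Q i, Qbar i]) us)"

lemma squares_simps [simp]:
  "squares [] = []" "squares (i # us) = [Q i, Qbar i] @ squares us"
  "squares (us @ vs) = squares us @ squares vs"
  by (simp_all add: squares_def)

lemma word_eq_squares_move: "word_eq (x @ squares us @ y) (squares us @ x @ y)"
proof (induction us arbitrary: x)
  case Nil
  then show ?case by (simp add: word_eq.refl)
next
  case (Cons i us)
  have "word_eq (x @ [Q i, bar (Q i)] @ squares us @ y) ([Q i, Qbar i] @ x @ squares us @ y)"
    using word_eq.move[of x "Q i" "squares us @ y"] by simp
  moreover have "word_eq ([Q i, Qbar i] @ (x @ squares us @ y) @ [])
      ([Q i, Qbar i] @ (squares us @ x @ y) @ [])"
    by (rule word_eq_append, rule Cons.IH)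
  ultimately show ?case using word_eq.trans by fastforce
qed

lemma word_eq_canonical:
  "\<exists>us. word_eq u (squares us @ snd (normal_form u)) \<and>
        (\<forall>i. count_list us i = fst (normal_form u) i)"
proof (induction u)
  case Nil
  show ?case by (rule exI[of _ "[]"]) (simp add: normal_form_def word_eq.refl)
next
  case (Cons l u)
  obtain \<alpha> w where s: "normal_form u = (\<alpha>, w)" by (cases "normal_form u")
  with Cons obtain us where us: "word_eq u (squares us @ w)" "\<forall>i. count_list us i = \<alpha> i"
    by auto
  have eq: "normal_form (l # u) = nf_cons l (\<alpha>, w)" using s by (simp add: normal_form_def)
  have "word_eq ([l] @ u @ []) ([l] @ (squares us @ w) @ [])"
    by (rule word_eq_append, rule us)
  moreover have "word_eq ([l] @ squares us @ w) (squares us @ [l] @ w)"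
    by (rule word_eq_squares_move)
  ultimately have *: "word_eq (l # u) (squares us @ l # w)"
    using word_eq.trans by fastforce
  show ?case
  proof (cases "\<exists>v. w = bar l # v")
    case False
    then have "nf_cons l (\<alpha>, w) = (\<alpha>, l # w)" by (cases w) auto
    then show ?thesis using * us eq by auto
  next
    case True
    then obtain v where v: "w = bar l # v" by blast
    have "word_eq (squares us @ [l, bar l] @ v) ([Q (idx l), Qbar (idx l)] @ squares us @ v)"
      by (rule word_eq.move)
    with * v have "word_eq (l # u) (squares (idx l # us) @ v)"
      using word_eq.trans by fastforce
    then show ?thesis using us eq v by (intro exI[of _ "idx l # us"]) auto
  qed
qed

lemma word_eq_squares_perm:
  "(\<And>i. count_list us i = count_list vs i) \<Longrightarrow> word_eq (squares us @ w) (squares vs @ w)"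
proof (induction us arbitrary: vs)
  case Nil
  then have "vs = []" by (metis count_list.simps(1) count_list_0_iff list.set_intros(1) neq_Nil_conv)
  then show ?case by (simp add: word_eq.refl)
next
  case (Cons i us)
  have "i \<in> set vs"
    using Cons.prems[of i] by (metis count_list.simps(2) count_list_0_iff add_is_0 one_neq_zero)
  then obtain xs ys where vs: "vs = xs @ i # ys" by (meson split_list)
  have "count_list us k = count_list (xs @ ys) k" for k
    using Cons.prems[of k] vs by (auto split: if_splits)
  then have "word_eq ([Q i, Qbar i] @ (squares us @ w) @ []) ([Q i, Qbar i] @ (squares (xs @ ys) @ w) @ [])"
    by (intro word_eq_append Cons.IH)
  moreover have "word_eq (squares vs @ w) ([Q i, Qbar i] @ squares (xs @ ys) @ w)"
    using word_eq.move[of "squares xs" "Q i" "squares ys @ w"] vs by simp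
  ultimately show ?case using word_eq.sym word_eq.trans by fastforce
qed

lemma same_nf_iff: "same_nf u v \<longleftrightarrow> word_eq u v"
proof
  assume "same_nf u v"
  then have nf: "normal_form u = normal_form v" by (simp add: same_nf_def)
  obtain us where us: "word_eq u (squares us @ snd (normal_form u))"
      "\<And>i. count_list us i = fst (normal_form u) i"
    using word_eq_canonical[of u] by blast
  obtain vs where vs: "word_eq v (squares vs @ snd (normal_form v))"
      "\<And>i. count_list vs i = fst (normal_form v) i"
    using word_eq_canonical[of v] by blast
  have "word_eq (squares us @ snd (normal_form u)) (squares vs @ snd (normal_form u))"
    using us vs nf by (intro word_eq_squares_perm) simp
  then show "word_eq u v" using us vs nf by (metis word_eq.sym word_eq.trans)
qed (rule word_eq_imp_same_nf)

quotient_type 'n qword = "'n letter list" / same_nf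
  by (rule equivpI) (auto simp: reflp_def symp_def transp_def same_nf_def)

text \<open>
  The product of words is written additively, because the convolution product of
  \<open>HOL-Library.Poly_Mapping\<close> (here: the monoid algebra of the words) expects a monoid in this
  notation. It is not commutative; \<open>0\<close> is the empty word.
\<close>

instantiation qword :: (type) monoid_add
begin

lift_definition zero_qword :: "'a qword" is "[]" .

lift_definition plus_qword :: "'a qword \<Rightarrow> 'a qword \<Rightarrow> 'a qword" is "(@)"
proof -
  fix u u' v v' :: "'a letter list"
  assume "same_nf u u'" "same_nf v v'"
  then have "word_eq ([] @ u @ v) ([] @ u' @ v)" "word_eq (u' @ v @ []) (u' @ v' @ [])"
    by (auto simp only: same_nf_iff intro: word_eq_append)
  then show "same_nf (u @ v) (u' @ v')"
    unfolding same_nf_iff using word_eq.trans by fastforce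
qed

instance
  by standard (transfer; simp add: same_nf_def)+

end

lift_definition letter_word :: "'n letter \<Rightarrow> 'n qword" is "\<lambda>l. [l]" .

lift_definition word_star :: "'n qword \<Rightarrow> 'n qword" is "\<lambda>u. map bar (rev u)"
proof -
  fix u v :: "'n letter list"
  assume "same_nf u v"
  then have "word_eq u v" by (simp add: same_nf_iff)
  then have "word_eq (map bar (rev u)) (map bar (rev v))"
  proof (induction rule: word_eq.induct)
    case (move u l v)
    let ?u = "map bar (rev u)" and ?v = "map bar (rev v)" and ?s = "[Q (idx l), Qbar (idx l)]"
    have "word_eq (?v @ [l, bar l] @ ?u) (?s @ ?v @ ?u)" by (rule word_eq.move)
    moreover have "word_eq ((?v @ ?u) @ [Q (idx l), bar (Q (idx l))] @ [])
        ([Q (idx (Q (idx l))), Qbar (idx (Q (idx l)))] @ (?v @ ?u) @ [])"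
      by (rule word_eq.move)
    ultimately show ?case using word_eq.sym word_eq.trans by fastforce
  qed (auto intro: word_eq.intros)
  then show "same_nf (map bar (rev u)) (map bar (rev v))" by (simp add: same_nf_iff)
qed

lemma word_star_simps [simp]:
  "word_star 0 = 0" "word_star (u + v) = word_star v + word_star u"
  "word_star (word_star u) = u" "word_star (letter_word l) = letter_word (bar l)"
  by (transfer; simp add: same_nf_def rev_map comp_def)+


section \<open>The real *-algebra of quaternionic polynomials\<close>

type_synonym 'n qpoly = "'n qword \<Rightarrow>\<^sub>0 real"

definition word_poly :: "'n qword \<Rightarrow> 'n qpoly" where
  "word_poly w = Poly_Mapping.single w 1"

definition q :: "'n \<Rightarrow> 'n qpoly" where
  "q i = word_poly (letter_word (Q i))"

definition star :: "'n qpoly \<Rightarrow> 'n qpoly" where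
  "star p = (\<Sum>w\<in>Poly_Mapping.keys p.
     Poly_Mapping.single (word_star w) (Poly_Mapping.lookup p w))"

definition commutator :: "'a::ring \<Rightarrow> 'a \<Rightarrow> 'a" where
  "commutator a b = a * b - b * a"

text \<open>
  Closure under real scalar multiples is part of closure under multiplication, the scalar
  \<open>r\<close> being the algebra element \<open>Poly_Mapping.single 0 r\<close>.
\<close>

definition star_ideal :: "'n qpoly set \<Rightarrow> bool" where
  "star_ideal I \<longleftrightarrow> 0 \<in> I \<and> (\<forall>a\<in>I. \<forall>b\<in>I. a + b \<in> I) \<and>
     (\<forall>a\<in>I. \<forall>r. r * a \<in> I \<and> a * r \<in> I) \<and> (\<forall>a\<in>I. star a \<in> I)"

definition star_ideal_generated :: "'n qpoly set \<Rightarrow> 'n qpoly set" where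
  "star_ideal_generated S = \<Inter> {I. star_ideal I \<and> S \<subseteq> I}"


section \<open>Evaluation in quaternionic polynomials with commuting central variables\<close>

text \<open>
  The variable \<open>(i, j)\<close> is \<open>x\<^sub>i\<^sub>j\<close> with \<open>j = 1, 2, 3, 4\<close> the four elements of the numeral type
  \<open>4\<close>. Exponent vectors form a commutative monoid, so the variables are central.
\<close>

type_synonym 'n hpoly = "(('n \<times> 4) \<Rightarrow>\<^sub>0 nat) \<Rightarrow>\<^sub>0 quat"

definition hconst :: "quat \<Rightarrow> 'n hpoly" where
  "hconst c = Poly_Mapping.single 0 c"

definition xvar :: "'n \<Rightarrow> 4 \<Rightarrow> 'n hpoly" where
  "xvar i j = Poly_Mapping.single (Poly_Mapping.single (i, j) 1) 1"

definition hcnj :: "'n hpoly \<Rightarrow> 'n hpoly" where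
  "hcnj = Poly_Mapping.map quat_cnj"

fun rho_letter :: "'n letter \<Rightarrow> 'n hpoly" where
  "rho_letter (Q i) =
     xvar i 1 + xvar i 2 * hconst quat_i + xvar i 3 * hconst quat_j + xvar i 4 * hconst quat_k"
| "rho_letter (Qbar i) =
     hcnj (xvar i 1 + xvar i 2 * hconst quat_i + xvar i 3 * hconst quat_j + xvar i 4 * hconst quat_k)"

lemma poly_mapping_single_induct [case_names single add]:
  assumes "\<And>k c. P (Poly_Mapping.single k c)" and "\<And>a b. P a \<Longrightarrow> P b \<Longrightarrow> P (a + b)"
  shows "P (p :: 'a \<Rightarrow>\<^sub>0 'b::comm_monoid_add)"
proof (induction p rule: Poly_Mapping.update_induct)
  case const
  then show ?case using assms(1)[of undefined 0] by simp
next
  case (update p k c)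
  have "Poly_Mapping.update k c p = Poly_Mapping.single k c + p"
    using update.hyps
    by (intro poly_mapping_eqI)
       (auto simp: lookup_update lookup_add lookup_single in_keys_iff when_def)
  then show ?case using assms update by simp
qed

lemma lookup_hcnj: "Poly_Mapping.lookup (hcnj p) k = quat_cnj (Poly_Mapping.lookup p k)"
  unfolding hcnj_def by transfer (simp add: when_def)

lemma hcnj_single [simp]: "hcnj (Poly_Mapping.single k c) = Poly_Mapping.single k (quat_cnj c)"
  by (intro poly_mapping_eqI) (simp add: lookup_hcnj lookup_single when_def)

lemma hcnj_add [simp]: "hcnj (a + b) = hcnj a + hcnj b"
  by (intro poly_mapping_eqI) (simp add: lookup_hcnj lookup_add)

lemma hcnj_0 [simp]: "hcnj 0 = 0"
  by (intro poly_mapping_eqI) (simp add: lookup_hcnj)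

lemma hcnj_sum [simp]: "hcnj (sum f A) = (\<Sum>x\<in>A. hcnj (f x))"
  by (induction A rule: infinite_finite_induct) auto

lemma hcnj_hcnj [simp]: "hcnj (hcnj p) = p"
  by (intro poly_mapping_eqI) (simp add: lookup_hcnj)

lemma hcnj_mult [simp]: "hcnj (a * b) = hcnj b * hcnj a"
proof (induction a rule: poly_mapping_single_induct)
  case (single k c)
  show ?case
    by (induction b rule: poly_mapping_single_induct)
       (simp_all add: mult_single add.commute algebra_simps)
qed (simp add: algebra_simps)

lemma hpoly_real_central:
  "Poly_Mapping.single k (quat_of_real r) * p = p * (Poly_Mapping.single k (quat_of_real r) :: 'n hpoly)"
  by (induction p rule: poly_mapping_single_induct)
     (simp_all add: mult_single add.commute quat_of_real_central algebra_simps)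

lemma rho_letter_Qbar:
  "rho_letter (Qbar i) =
     xvar i 1 - xvar i 2 * hconst quat_i - xvar i 3 * hconst quat_j - xvar i 4 * hconst quat_k"
  by (simp add: xvar_def hconst_def mult_single quat_cnj_def quat_defs quat_i_def quat_j_def
        quat_k_def flip: single_uminus add_uminus_conv_diff)

lemma rho_letter_bar: "rho_letter (bar l) = hcnj (rho_letter l)"
  by (cases l) auto

definition normsq :: "'n \<Rightarrow> 'n hpoly" where
  "normsq i = xvar i 1 * xvar i 1 + xvar i 2 * xvar i 2 + xvar i 3 * xvar i 3 + xvar i 4 * xvar i 4"

lemma normsq_central: "normsq i * p = p * normsq i"
proof -
  have "normsq i = (\<Sum>j\<in>{1,2,3,4}. Poly_Mapping.single
      (Poly_Mapping.single (i, j) 1 + Poly_Mapping.single (i, j) 1) (quat_of_real 1))"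
    by (simp add: normsq_def xvar_def mult_single)
  then show ?thesis
    by (simp only: sum_distrib_left sum_distrib_right hpoly_real_central)
qed

lemma rho_letter_mult_bar: "rho_letter l * rho_letter (bar l) = normsq (idx l)"
proof -
  have neg: "Poly_Mapping.single k (Quat (- 1) 0 0 0) = - Poly_Mapping.single k (Quat 1 0 0 0)"
      "Poly_Mapping.single k (Quat 0 (- 1) 0 0) = - Poly_Mapping.single k (Quat 0 1 0 0)"
      "Poly_Mapping.single k (Quat 0 0 (- 1) 0) = - Poly_Mapping.single k (Quat 0 0 1 0)"
      "Poly_Mapping.single k (Quat 0 0 0 (- 1)) = - Poly_Mapping.single k (Quat 0 0 0 1)"
    for k :: "('n \<times> 4) \<Rightarrow>\<^sub>0 nat"
    by (simp_all add: uminus_quat_def flip: single_uminus)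
  have "rho_letter (Q i) * rho_letter (Qbar i) = normsq i"
       "rho_letter (Qbar i) * rho_letter (Q i) = normsq i" for i :: 'n
    unfolding rho_letter_Qbar
    by (simp_all add: normsq_def xvar_def hconst_def mult_single quat_i_def quat_j_def quat_k_def
          quat_defs neg algebra_simps)
  then show ?thesis by (cases l) auto
qed

lift_definition rho_word :: "'n qword \<Rightarrow> 'n hpoly" is "\<lambda>u. prod_list (map rho_letter u)"
proof -
  fix u v :: "'n letter list"
  assume "same_nf u v"
  then have "word_eq u v" by (simp add: same_nf_iff)
  then show "prod_list (map rho_letter u) = prod_list (map rho_letter v)"
  proof (induction rule: word_eq.induct)
    case (move u l v)
    let ?p = "\<lambda>u. prod_list (map rho_letter u)"
    have "?p (u @ [l, bar l] @ v) = ?p u * (rho_letter l * rho_letter (bar l)) * ?p v"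
      by (simp add: mult.assoc)
    also have "\<dots> = (rho_letter (Q (idx l)) * rho_letter (bar (Q (idx l)))) * ?p u * ?p v"
      by (simp only: rho_letter_mult_bar normsq_central idx.simps)
    finally show ?case by (simp add: mult.assoc del: rho_letter.simps)
  qed auto
qed

definition rho :: "'n qpoly \<Rightarrow> 'n hpoly" where
  "rho p = (\<Sum>w\<in>Poly_Mapping.keys p. hconst (quat_of_real (Poly_Mapping.lookup p w)) * rho_word w)"

text \<open>The real scalar-identity ideal \<open>\<I>\<^sub>n\<^sup>\<real>\<close>, where \<open>n\<close> is the cardinality of the type \<open>'n\<close>.\<close>

definition real_identity_ideal :: "'n::finite qpoly set" where
  "real_identity_ideal = {p. rho p = 0}"


text \<open>The map \<open>rho\<close> is the unital *-homomorphism determined by its values on the letters.\<close>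

lemma rho_word_simps [simp]:
  "rho_word 0 = 1" "rho_word (u + v) = rho_word u * rho_word v"
  "rho_word (letter_word l) = rho_letter l"
  by (transfer; simp)+

lemma hconst_simps:
  "hconst 0 = 0" "hconst 1 = 1" "hconst (a + b) = hconst a + hconst b"
  "hconst (a * b) = hconst a * hconst b"
  by (simp_all add: hconst_def single_add mult_single)

lemma rho_word_star: "rho_word (word_star w) = hcnj (rho_word w)"
proof (transfer)
  fix u :: "'n letter list"
  show "prod_list (map rho_letter (map bar (rev u))) = hcnj (prod_list (map rho_letter u))"
  proof (induction u)
    case Nil
    have "hcnj (1 :: 'n hpoly) = 1"
      using hcnj_single[of 0 1] by simp
    then show ?case by simp
  qed (simp add: rho_letter_bar)
qed

lemma rho_single [simp]: "rho (Poly_Mapping.single w r) = hconst (quat_of_real r) * rho_word w"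
  by (simp add: rho_def hconst_simps)

lemma rho_add [simp]: "rho (a + b) = rho a + rho b"
  unfolding rho_def by (rule setsum_keys_plus_distrib) (simp_all add: hconst_simps algebra_simps)

lemma rho_one: "rho 1 = 1"
  using rho_single[of 0 1] by (simp add: hconst_simps)

lemma rho_mult: "rho (a * b) = rho a * rho b"
proof (induction a rule: poly_mapping_single_induct)
  case (single u r)
  show ?case
  proof (induction b rule: poly_mapping_single_induct)
    case (single v s)
    have "rho_word u * hconst (quat_of_real s) = hconst (quat_of_real s) * rho_word u"
      by (simp add: hconst_def hpoly_real_central)
    then show ?case by (simp add: mult_single hconst_simps mult.assoc) (simp flip: mult.assoc)
  qed (simp add: algebra_simps)
qed (simp add: algebra_simps)

lemma star_single [simp]: "star (Poly_Mapping.single w r) = Poly_Mapping.single (word_star w) r"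
  by (simp add: star_def)

lemma star_add [simp]: "star (a + b) = star a + star b"
  unfolding star_def by (rule setsum_keys_plus_distrib) (simp_all add: single_add)

lemma star_mult: "star (a * b) = star b * star a"
proof (induction a rule: poly_mapping_single_induct)
  case (single u r)
  show ?case
    by (induction b rule: poly_mapping_single_induct) (simp_all add: mult_single algebra_simps)
qed (simp add: algebra_simps)

lemma star_star: "star (star p) = p"
  by (induction p rule: poly_mapping_single_induct) simp_all

lemma rho_star: "rho (star p) = hcnj (rho p)"
  by (induction p rule: poly_mapping_single_induct)
     (simp_all add: rho_word_star hconst_def hpoly_real_central)

lemma rho_q: "rho (q i) = rho_letter (Q i)" "rho (star (q i)) = rho_letter (Qbar i)"
  by (simp_all add: q_def word_poly_def hconst_simps del: rho_letter.simps)

end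

theory Submission
  imports Defs "HOL-Library.Multiset"
begin

text \<open>
  Let \<open>A\<close> be the quotient of the free algebra by the ideal that makes all traces \<open>w + w\<^sup>*\<close>
  central. In \<open>A\<close> the elements \<open>v\<^sub>i = q\<^sub>i - q\<^sub>i\<^sup>*\<close> behave like vectors in three-space, with
  \<open>[v\<^sub>a, v\<^sub>b]\<close> as cross product and the central elements \<open>v\<^sub>a [v\<^sub>b, v\<^sub>c] + [v\<^sub>b, v\<^sub>c] v\<^sub>a\<close> as
  determinant. Call these elements columns of length one, two and three. Their products obey
  straightening laws that follow from the centrality of the traces alone, so \<open>A\<close> is spanned by
  monomials in the traces \<open>q\<^sub>i + q\<^sub>i\<^sup>*\<close> times products of columns forming a semistandard tableau.
  Under evaluation in quaternionic polynomials a column \<open>a < b < c\<close> has leading monomial \<open>x\<^sub>a\<^sub>2 x\<^sub>b\<^sub>3 x\<^sub>c\<^sub>4\<close>, from which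
  the tableau can be read off. Hence the standard monomials stay linearly independent, and \<open>A\<close>
  embeds.
\<close>

section \<open>Algebras with central traces\<close>

text \<open>All laws rest on one fact: for skew \<open>a\<close>, \<open>b\<close> the element
  \<open>a * b + b * a\<close> is the trace of \<open>a * b\<close>, hence central. It plays the
  role of a scalar product. Scalar products need no generators of their own, since
  \<open>anticomm a b\<close> is \<open>2 * (a * b) - commutator a b\<close>.

  The obstacle is that columns of length one and two do not commute, and reordering them creates
  longer columns. The rewriting is controlled by a weight that is, up to sign and a constant 9n per
  column, the weight selecting leading monomials later on. Two columns are replaced by their
  entrywise minimum and maximum, which have the same leading monomial as the original pair, plus
  pairs whose leading monomials have strictly larger weight.\<close>

definition anticomm :: "'a::ring \<Rightarrow> 'a \<Rightarrow> 'a" where "anticomm a b = a * b + b * a"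

text \<open>On purely imaginary quaternions \<open>anticomm\<close> is -2 times the scalar product
  and \<open>commutator\<close> twice the cross product, so this is -4 times the
  determinant.\<close>

definition triple :: "'a::ring \<Rightarrow> 'a \<Rightarrow> 'a \<Rightarrow> 'a" where
  "triple a b c = anticomm a (commutator b c)"

locale central_trace =
  fixes st :: "'a::real_algebra_1 \<Rightarrow> 'a"
  assumes st_add: "st (a + b) = st a + st b"
    and st_mult: "st (a * b) = st b * st a"
    and trace_central: "(a + st a) * b = b * (a + st a)"
begin

definition skew :: "'a \<Rightarrow> bool" where "skew a \<longleftrightarrow> st a = - a"

lemma st_diff: "st (a - b) = st a - st b"
  by (metis add_diff_cancel_right' diff_add_cancel st_add)

lemma skew_commutator: "skew a \<Longrightarrow> skew b \<Longrightarrow> skew (commutator a b)"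
  by (simp add: skew_def commutator_def st_diff st_mult)

text \<open>Both signs cancel in \<open>st (a * b) = b * a\<close>, so the anticommutator is a
  trace.\<close>

lemma anticomm_central: "skew a \<Longrightarrow> skew b \<Longrightarrow> anticomm a b * c = c * anticomm a b"
  using trace_central[of "a * b" c] by (simp add: skew_def anticomm_def st_mult)

lemma triple_central: "skew a \<Longrightarrow> skew b \<Longrightarrow> skew c \<Longrightarrow> triple a b c * x = x * triple a b c"
  unfolding triple_def by (intro anticomm_central skew_commutator)

lemma commutator_swap: "commutator a b = - commutator b a"
  by (simp add: commutator_def)

lemma triple_swap23: "triple a b c = - triple a c b"
  by (simp add: triple_def anticomm_def commutator_def algebra_simps)

text \<open>The two sides differ by the commutator of the central element
  \<open>anticomm a c\<close> with \<open>b\<close>.\<close>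

lemma anticomm_invariant:
  assumes "skew a" "skew b" "skew c"
  shows "anticomm (commutator a b) c = anticomm a (commutator b c)"
  using anticomm_central[of a c b] assms
  by (simp add: anticomm_def commutator_def algebra_simps)

text \<open>The two sides differ by the commutator of the central element
  \<open>anticomm a b\<close> with \<open>c\<close>.\<close>

lemma triple_rotate:
  assumes "skew a" "skew b" "skew c"
  shows "triple a b c = triple b c a"
  using anticomm_central[of a b c] assms
  by (simp add: triple_def anticomm_def commutator_def algebra_simps)

lemma triple_swap12:
  assumes "skew a" "skew b" "skew c"
  shows "triple a b c = - triple b a c"
  unfolding triple_rotate[OF assms(2,1,3)] by (rule triple_swap23)

lemma triple_swap13:
  assumes "skew a" "skew b" "skew c"
  shows "triple a b c = - triple c b a"
  unfolding triple_rotate[OF assms(3,2,1)] triple_rotate[OF assms(2,1,3)] by (rule triple_swap23)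

lemma triple_eq_0:
  assumes "skew a" "skew b"
  shows "triple a b b = 0" "triple b a b = 0" "triple b b a = 0"
proof -
  show "triple a b b = 0" by (simp add: triple_def anticomm_def commutator_def)
  then show "triple b a b = 0" "triple b b a = 0"
    unfolding triple_rotate[OF assms(2,2,1)] triple_rotate[OF assms(2,1,2)] by simp_all
qed

text \<open>The expansion of an iterated cross product. The four terms regroup into anticommutators
  multiplied from both sides, and centrality merges the two sides.\<close>

lemma double_commutator:
  assumes "skew x" "skew y" "skew z"
  shows "commutator x (commutator y z) = 2 * (anticomm x y * z - anticomm x z * y)"
proof -
  have "commutator x (commutator y z) =
      (anticomm x y * z + z * anticomm x y) - (anticomm x z * y + y * anticomm x z)"
    by (simp add: anticomm_def commutator_def algebra_simps)
  then show ?thesis using assms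
    by (simp add: anticomm_central[of x y z, symmetric] anticomm_central[of x z y, symmetric] algebra_simps mult_2)
qed

text \<open>The double commutator formula with \<open>x\<close> the commutator of \<open>a\<close>
  and \<open>b\<close>; invariance turns its anticommutators with \<open>c\<close> and
  \<open>d\<close> into triples.\<close>

lemma commutator_commutators:
  assumes "skew a" "skew b" "skew c" "skew d"
  shows "commutator (commutator a b) (commutator c d) = 2 * (triple a b c * d - triple a b d * c)"
  using assms double_commutator[of "commutator a b" c d]
  by (simp add: skew_commutator anticomm_invariant flip: triple_def)

lemma double_cancel: "2 * x = 2 * (y::'a) \<Longrightarrow> x = y"
proof -
  assume "2 * x = 2 * y"
  then have "2 *\<^sub>R x = 2 *\<^sub>R y" by (metis scaleR_2 mult_2)
  then show ?thesis by simp
qed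

text \<open>The two ways of expanding the commutator of two commutators agree.\<close>

lemma exchange:
  assumes "skew a" "skew b" "skew c" "skew e"
  shows "triple a b c * e = triple e b c * a + triple a e c * b + triple a b e * c"
proof -
  have "2 * (triple a b c * e - triple a b e * c) = 2 * (triple c e b * a - triple c e a * b)"
    using commutator_commutators[of a b c e] commutator_commutators[of c e a b] assms
      commutator_swap[of "commutator a b" "commutator c e"] by (simp add: algebra_simps)
  then have "triple a b c * e - triple a b e * c = triple c e b * a - triple c e a * b"
    by (rule double_cancel)
  moreover have "triple c e b = triple e b c" by (intro triple_rotate assms)
  moreover have "triple c e a = - triple a e c" by (intro triple_swap13 assms)
  ultimately show ?thesis by (simp add: algebra_simps)
qed

lemma mult_3: "3 * x = x + x + (x::'a)"
proof -
  have "3 * x = (2 + 1) * x" by simp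
  then show ?thesis unfolding distrib_right mult_2 by simp
qed

text \<open>Each double commutator equals a triple minus twice a product such as
  \<open>commutator b c * a\<close>. The Jacobi identity removes the double commutators, and
  rotation identifies the three triples. This is the relation that straightens a column of length
  two times a column of length one.\<close>

lemma jacobi:
  assumes "skew a" "skew b" "skew c"
  shows "2 * (commutator b c * a + commutator c a * b + commutator a b * c) = 3 * triple a b c"
proof -
  have J: "commutator a (commutator b c) + commutator b (commutator c a) + commutator c (commutator a b) = 0"
    by (simp add: commutator_def algebra_simps)
  have *: "commutator x y = anticomm x y - 2 * (y * x)" for x y :: 'a
    by (simp add: commutator_def anticomm_def algebra_simps mult_2)
  have "triple a b c + triple b c a + triple c a b
      = 2 * (commutator b c * a + commutator c a * b + commutator a b * c)"
    using J unfolding *[of a "commutator b c"] *[of b "commutator c a"] *[of c "commutator a b"]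
    by (simp add: triple_def algebra_simps)
  moreover have "triple b c a = triple a b c" "triple c a b = triple a b c"
    using triple_rotate[OF assms] triple_rotate[OF assms(3,1,2)] by simp_all
  ultimately show ?thesis by (simp add: mult_3 algebra_simps)
qed

text \<open>The Binet-Cauchy identity for the scalar product of two cross products: invariance moves
  \<open>b\<close> across, then the double commutator is expanded.\<close>

lemma anticomm_commutators:
  assumes "skew a" "skew b" "skew c" "skew d"
  shows "anticomm (commutator a b) (commutator c d)
     = 2 * (anticomm b c * anticomm a d - anticomm b d * anticomm a c)"
proof -
  have *: "anticomm a (z * x) = z * anticomm a x" if "\<And>y. z * y = y * z" for x z
  proof -
    have "anticomm a (z * x) = a * z * x + z * x * a" by (simp add: anticomm_def mult.assoc)
    then show ?thesis by (simp add: anticomm_def that[symmetric] algebra_simps)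
  qed
  have "anticomm (commutator a b) (commutator c d) = anticomm a (commutator b (commutator c d))"
    using assms by (intro anticomm_invariant skew_commutator)
  also have "\<dots> = 2 * (anticomm a (anticomm b c * d) - anticomm a (anticomm b d * c))"
    using assms by (simp add: double_commutator) (simp add: anticomm_def algebra_simps mult_2 mult_2_right)
  also have "\<dots> = 2 * (anticomm b c * anticomm a d - anticomm b d * anticomm a c)"
    using assms *[of "anticomm b c" d] *[of "anticomm b d" c] anticomm_central by metis
  finally show ?thesis .
qed

lemma anticomm_sym: "anticomm a b = anticomm b a"
  by (simp add: anticomm_def add.commute)

text \<open>After Binet-Cauchy every product of two anticommutators occurs twice with opposite
  signs. The relation serves pairs of columns nested like intervals.\<close>

lemma anticomm_commutators_cyclic:
  assumes "skew a" "skew b" "skew c" "skew d"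
  shows "anticomm (commutator a b) (commutator c d) + anticomm (commutator b c) (commutator a d)
     + anticomm (commutator c a) (commutator b d) = 0"
proof -
  have 1: "anticomm (commutator a b) (commutator c d)
      = 2 * (anticomm b c * anticomm a d) - 2 * (anticomm b d * anticomm a c)"
    using anticomm_commutators[OF assms] by (simp only: right_diff_distrib)
  have "anticomm (commutator b c) (commutator a d)
      = 2 * (anticomm a c * anticomm b d) - 2 * (anticomm c d * anticomm a b)"
    using anticomm_commutators[OF assms(2,3,1,4)] anticomm_sym[of c a] anticomm_sym[of b a]
    by (simp only: right_diff_distrib)
  also have "anticomm a c * anticomm b d = anticomm b d * anticomm a c"
    by (intro anticomm_central assms)
  finally have 2: "anticomm (commutator b c) (commutator a d)
      = 2 * (anticomm b d * anticomm a c) - 2 * (anticomm c d * anticomm a b)" .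
  have "anticomm (commutator c a) (commutator b d)
      = 2 * (anticomm a b * anticomm c d) - 2 * (anticomm a d * anticomm b c)"
    using anticomm_commutators[OF assms(3,1,2,4)] anticomm_sym[of c b]
    by (simp only: right_diff_distrib)
  also have "anticomm a b * anticomm c d = anticomm c d * anticomm a b"
    by (intro anticomm_central assms)
  also have "anticomm a d * anticomm b c = anticomm b c * anticomm a d"
    by (intro anticomm_central assms)
  finally have 3: "anticomm (commutator c a) (commutator b d)
      = 2 * (anticomm c d * anticomm a b) - 2 * (anticomm b c * anticomm a d)" .
  show ?thesis unfolding 1 2 3 by simp
qed

end

section \<open>Straightening products of columns\<close>

locale skew_columns = central_trace st for st :: "'a::real_algebra_1 \<Rightarrow> 'a" +
  fixes v :: "nat \<Rightarrow> 'a" and n :: nat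
  assumes skew_v [simp]: "skew (v i)"
begin

text \<open>
  A column is coded as a triple padded with \<open>NA\<close>. The value \<open>3 n\<close> is large enough that the total
  weight drops whenever two columns of length at most two give way to one of length three.
\<close>

abbreviation "NA \<equiv> 3 * n"

fun valid :: "nat \<times> nat \<times> nat \<Rightarrow> bool" where
  "valid (a, b, c) \<longleftrightarrow> (a < b \<and> b < c \<and> c < n) \<or> (a < b \<and> b < n \<and> c = NA) \<or>
     (a < n \<and> b = NA \<and> c = NA) \<or> (a = NA \<and> b = NA \<and> c = NA)"

fun column :: "nat \<times> nat \<times> nat \<Rightarrow> 'a" where
  "column (a, b, c) = (if c < n then triple (v a) (v b) (v c)
     else if b < n then commutator (v a) (v b) else if a < n then v a else 1)"

text \<open>Up to the constant 9n this is the negative of the weight of the leading monomial, where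
  a middle entry \<open>b\<close> will cost 3n - b and a last entry \<open>c\<close> will cost 2(3n
  - c). Padding by 3n then costs nothing, and a smaller column weight means a heavier leading
  monomial.\<close>

fun column_weight :: "nat \<times> nat \<times> nat \<Rightarrow> nat" where
  "column_weight (a, b, c) = b + 2 * c"

fun meet :: "nat \<times> nat \<times> nat \<Rightarrow> nat \<times> nat \<times> nat \<Rightarrow> nat \<times> nat \<times> nat" where
  "meet (a, b, c) (e, f, g) = (min a e, min b f, min c g)"

fun join :: "nat \<times> nat \<times> nat \<Rightarrow> nat \<times> nat \<times> nat \<Rightarrow> nat \<times> nat \<times> nat" where
  "join (a, b, c) (e, f, g) = (max a e, max b f, max c g)"

text \<open>Meet and join keep the entries of each row, hence the total weight; every other pair
  must be of smaller weight. Exactly two columns are kept, possibly empty ones, so that weights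
  before and after are comparable.\<close>

definition straightening :: "nat \<times> nat \<times> nat \<Rightarrow> nat \<times> nat \<times> nat \<Rightarrow> 'a set" where
  "straightening C D = span {column C' * column D' | C' D'. valid C' \<and> valid D' \<and>
     (column_weight C' + column_weight D' < column_weight C + column_weight D \<or> C' = meet C D \<and> D' = join C D)}"

lemma straightening_low:
  "valid C' \<Longrightarrow> valid D' \<Longrightarrow> column_weight C' + column_weight D' < column_weight C + column_weight D \<Longrightarrow>
     column C' * column D' \<in> straightening C D"
  unfolding straightening_def by (rule span_base) blast

lemma straightening_main:
  "valid C' \<Longrightarrow> valid D' \<Longrightarrow> C' = meet C D \<Longrightarrow> D' = join C D \<Longrightarrow> column C' * column D' \<in> straightening C D"
  unfolding straightening_def by (rule span_base) blast

lemma straightening_sym: "straightening C D = straightening D C"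
proof -
  have "meet C D = meet D C" "join C D = join D C"
    by (cases C; cases D; simp add: min.commute max.commute)+
  then show ?thesis by (simp add: straightening_def add.commute)
qed

lemma straightening_closed:
  "0 \<in> straightening C D"
  "x \<in> straightening C D \<Longrightarrow> y \<in> straightening C D \<Longrightarrow> x + y \<in> straightening C D"
  "x \<in> straightening C D \<Longrightarrow> y \<in> straightening C D \<Longrightarrow> x - y \<in> straightening C D"
  "x \<in> straightening C D \<Longrightarrow> - x \<in> straightening C D"
  "x \<in> straightening C D \<Longrightarrow> r *\<^sub>R x \<in> straightening C D"
  unfolding straightening_def by (simp_all add: span_zero span_add span_diff span_neg span_scale)

lemma straightening_double: "2 * x \<in> straightening C D \<longleftrightarrow> x \<in> straightening C D"
proof
  assume "2 * x \<in> straightening C D"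
  then have "(1/2) *\<^sub>R (2 * x) \<in> straightening C D" by (rule straightening_closed)
  moreover have "2 * x = 2 *\<^sub>R x" by (metis scaleR_2 mult_2)
  ultimately show "x \<in> straightening C D" by simp
next
  assume "x \<in> straightening C D"
  then show "2 * x \<in> straightening C D" by (simp add: mult_2 straightening_closed)
qed

text \<open>Since \<open>triple\<close> is alternating, sorting its entries costs at most a sign and
  a repeated entry gives zero, so strictly increasing columns suffice.\<close>

lemma straightening_triple:
  assumes "x < n" "y < n" "z < n"
    and *: "\<And>a b c. a < b \<Longrightarrow> b < c \<Longrightarrow> c < n \<Longrightarrow> column (a, b, c) * u \<in> straightening C D"
  shows "triple (v x) (v y) (v z) * u \<in> straightening C D"
proof -
  have t: "triple (v a) (v b) (v c) * u \<in> straightening C D" if "a < b" "b < c" "c < n" for a b c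
    using *[OF that] that by simp
  consider "x = y \<or> x = z \<or> y = z" | "x < y" "y < z" | "x < z" "z < y" | "y < x" "x < z"
    | "y < z" "z < x" | "z < x" "x < y" | "z < y" "y < x" by linarith
  then show ?thesis
  proof cases
    case 1
    then show ?thesis by (auto simp: triple_eq_0 straightening_closed)
  next
    case 2
    then show ?thesis using t assms by simp
  next
    case 3
    then show ?thesis using t[of x z y] assms triple_swap23[of "v x" "v y" "v z"] by (simp add: straightening_closed)
  next
    case 4
    then show ?thesis using t[of y x z] assms triple_swap12[of "v x" "v y" "v z"] by (simp add: straightening_closed)
  next
    case 5
    then show ?thesis using t[of y z x] assms triple_rotate[of "v x" "v y" "v z"] by simp
  next
    case 6
    then show ?thesis using t[of z x y] assms triple_rotate[of "v z" "v x" "v y"] by simp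
  next
    case 7
    then show ?thesis using t[of z y x] assms triple_swap13[of "v x" "v y" "v z"] by (simp add: straightening_closed)
  qed
qed

section \<open>Exchange relations between two columns\<close>

lemma column_swap12: "a < n \<Longrightarrow> b < n \<Longrightarrow> column (a, b, c) = - column (b, a, c)"
  by (simp add: triple_swap12[of "v a" "v b"] commutator_swap[of "v a" "v b"])

text \<open>The map \<open>ext\<close> completes a vector to the second column by putting it in the
  head. It is additive and lets central factors through, so applying it to the law
  \<open>exchange\<close> gives the claim for second columns of any length.\<close>

lemma column_exchange1:
  assumes "a < n" "b < n" "c < n" "e < n"
  shows "column (a, b, c) * column (e, f, g) = column (e, b, c) * column (a, f, g)
     + column (a, e, c) * column (b, f, g) + column (a, b, e) * column (c, f, g)"
proof -
  define ext where "ext y = (if g < n then triple y (v f) (v g)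
    else if f < n then commutator y (v f) else y)" for y
  have add: "ext (x + y) = ext x + ext y" for x y
    by (simp add: ext_def triple_def anticomm_def commutator_def algebra_simps)
  have mult: "ext (z * y) = z * ext y" if z: "\<And>x. z * x = x * z" for z y
  proof -
    have "triple (z * y) p r = z * triple y p r" for p r
      unfolding triple_def anticomm_def
      using z[of "commutator p r"] by (simp add: distrib_left mult.assoc flip: mult.assoc[of _ z] z)
    moreover have "commutator (z * y) p = z * commutator y p" for p
      unfolding commutator_def
      by (simp add: right_diff_distrib mult.assoc flip: mult.assoc[of _ z] z)
    ultimately show ?thesis by (simp add: ext_def)
  qed
  have ext: "column (x, f, g) = ext (v x)" if "x < n" for x
    using that by (simp add: ext_def)
  have "ext (triple (v a) (v b) (v c) * v e) = ext (triple (v e) (v b) (v c) * v a)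
     + ext (triple (v a) (v e) (v c) * v b) + ext (triple (v a) (v b) (v e) * v c)"
    by (simp only: exchange[of "v a" "v b" "v c" "v e"] skew_v add)
  moreover have "ext (triple (v p) (v q) (v r) * y) = triple (v p) (v q) (v r) * ext y" for p q r y
    by (rule mult) (simp add: triple_central)
  moreover have "column (p, q, r) = triple (v p) (v q) (v r)" if "r < n" for p q r
    using that by simp
  ultimately show ?thesis by (simp only: ext assms)
qed

text \<open>Exchange \<open>e\<close>, then \<open>f\<close> in each resulting product. Every wanted
  term arises twice, and the remaining terms add up to minus the expansion obtained by exchanging
  \<open>f\<close> alone, that is, minus the original product. Hence twice the product is twice the
  claimed sum.\<close>

lemma column_exchange2:
  assumes "a < n" "b < n" "c < n" "e < n" "f < n"
  shows "column (a, b, c) * column (e, f, g) = column (e, f, c) * column (a, b, g)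
     + column (e, b, f) * column (a, c, g) + column (a, e, f) * column (b, c, g)"
proof -
  note less = assms
  have x: "column (a, b, c) * column (e, f, g) = column (e, b, c) * column (a, f, g)
     + column (a, e, c) * column (b, f, g) + column (a, b, e) * column (c, f, g)"
    by (rule column_exchange1) (use less in auto)
  have "column (e, b, c) * column (f, a, g) = column (f, b, c) * column (e, a, g)
     + column (e, f, c) * column (b, a, g) + column (e, b, f) * column (c, a, g)"
    by (rule column_exchange1) (use less in auto)
  moreover have "column (f, a, g) = - column (a, f, g)" "column (b, a, g) = - column (a, b, g)"
      "column (c, a, g) = - column (a, c, g)"
    using less column_swap12 by blast+
  ultimately have x1: "column (e, b, c) * column (a, f, g) = - (column (f, b, c) * column (e, a, g))
     + column (e, f, c) * column (a, b, g) + column (e, b, f) * column (a, c, g)"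
    by (simp add: algebra_simps minus_equation_iff[of "_ * _"] del: column.simps)
  have "column (a, e, c) * column (f, b, g) = column (f, e, c) * column (a, b, g)
     + column (a, f, c) * column (e, b, g) + column (a, e, f) * column (c, b, g)"
    by (rule column_exchange1) (use less in auto)
  moreover have "column (f, b, g) = - column (b, f, g)" "column (f, e, c) = - column (e, f, c)"
      "column (c, b, g) = - column (b, c, g)"
    using less column_swap12 by blast+
  ultimately have x2: "column (a, e, c) * column (b, f, g) = column (e, f, c) * column (a, b, g)
     - column (a, f, c) * column (e, b, g) + column (a, e, f) * column (b, c, g)"
    by (simp add: algebra_simps minus_equation_iff[of "_ * _"] del: column.simps)
  have "column (a, b, e) * column (f, c, g) = column (f, b, e) * column (a, c, g)
     + column (a, f, e) * column (b, c, g) + column (a, b, f) * column (e, c, g)"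
    by (rule column_exchange1) (use less in auto)
  moreover have "column (f, c, g) = - column (c, f, g)"
    using less column_swap12 by blast+
  moreover have "column (f, b, e) = - column (e, b, f)" "column (a, f, e) = - column (a, e, f)"
    using less triple_swap13[of "v f" "v b" "v e"] triple_swap23[of "v a" "v f" "v e"] by simp_all
  ultimately have x3: "column (a, b, e) * column (c, f, g) = column (e, b, f) * column (a, c, g)
     + column (a, e, f) * column (b, c, g) - column (a, b, f) * column (e, c, g)"
    by (simp add: algebra_simps minus_equation_iff[of "_ * _"] del: column.simps)
  have "column (a, b, c) * column (f, e, g) = column (f, b, c) * column (a, e, g)
     + column (a, f, c) * column (b, e, g) + column (a, b, f) * column (c, e, g)"
    by (rule column_exchange1) (use less in auto)
  moreover have "column (f, e, g) = - column (e, f, g)" "column (a, e, g) = - column (e, a, g)"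
      "column (b, e, g) = - column (e, b, g)" "column (c, e, g) = - column (e, c, g)"
    using less column_swap12 by blast+
  ultimately have x4: "column (a, b, c) * column (e, f, g) = column (f, b, c) * column (e, a, g)
     + column (a, f, c) * column (e, b, g) + column (a, b, f) * column (e, c, g)"
    by (simp add: algebra_simps minus_equation_iff[of "_ * _"] del: column.simps)
  have "2 * (column (a, b, c) * column (e, f, g)) = 2 * (column (e, f, c) * column (a, b, g)
     + column (e, b, f) * column (a, c, g) + column (a, e, f) * column (b, c, g))"
    unfolding mult_2 by (subst x, subst x4, unfold x1 x2 x3) (simp add: algebra_simps del: column.simps)
  then show ?thesis by (rule double_cancel)
qed

text \<open>The hypothesis \<open>c \<le> g\<close> puts the last row in order, so only the first
  two rows can be wrong. Exactly the offending entries of the second column are exchanged: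
  \<open>e\<close>, \<open>f\<close>, or both. One summand is the product of meet and join; in the
  others an entry repeats, or smaller entries move into heavier positions.\<close>

lemma straightening_triple_column:
  assumes "valid (a, b, c)" "c < n" "valid (e, f, g)" "c \<le> g"
  shows "column (a, b, c) * column (e, f, g) \<in> straightening (a, b, c) (e, f, g)"
proof -
  let ?G = "straightening (a, b, c) (e, f, g)"
  have abc: "a < b" "b < c" "a < n" "b < n" using assms by auto
  have low: "column C' * column D' \<in> ?G" if "valid C'" "valid D'" "column_weight C' + column_weight D' < b + 2 * c + f + 2 * g" for C' D'
    using straightening_low[OF that(1,2), of "(a,b,c)" "(e,f,g)"] that(3) by simp
  have main: "column (min a e, min b f, c) * column (max a e, max b f, g) \<in> ?G"
    if "valid (min a e, min b f, c)" "valid (max a e, max b f, g)"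
    using straightening_main[OF that, of "(a,b,c)" "(e,f,g)"] assms(4) by simp
  consider "a \<le> e" "b \<le> f" | "e < a" "b \<le> f" | "e < a" "f < b" | "a \<le> e" "f < b" by linarith
  then show ?thesis
  proof cases
    case 1
    then show ?thesis using main assms by (simp add: min_def max_def del: column.simps)
  next
    case 2
    then have e: "e < n" using abc by simp
    have "valid (e, b, c)" "valid (a, f, g)" using 2 assms abc by auto
    then have 21: "column (e, b, c) * column (a, f, g) \<in> ?G"
      using main 2 by (simp add: min_def max_def del: column.simps)
    have 22: "column (a, e, c) * column (b, f, g) \<in> ?G"
    proof (cases "b = f")
      case True
      then have "column (b, f, g) = 0" using abc by (simp add: triple_eq_0 commutator_def)
      then show ?thesis by (simp add: straightening_closed del: column.simps)
    next
      case False
      then have "column (e, a, c) * column (b, f, g) \<in> ?G"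
        using 2 assms abc by (intro low) auto
      then show ?thesis using column_swap12[of a e c] abc e by (simp add: straightening_closed del: column.simps)
    qed
    have rot: "column (a, b, e) = column (e, a, b)"
      using abc e triple_rotate[of "v e" "v a" "v b"] by simp
    have 23: "column (a, b, e) * column (c, f, g) \<in> ?G"
    proof -
      consider "c = f \<or> c = g" | "c < f" "c < g" | "f < c" "c < g" using assms by linarith
      then show ?thesis
      proof cases
        case 1
        then have "column (c, f, g) = 0" using assms(2) by (auto simp: triple_eq_0 commutator_def)
        then show ?thesis by (simp add: straightening_closed del: column.simps)
      next
        case c: 2
        then show ?thesis unfolding rot using 2 assms abc by (intro low) auto
      next
        case c: 3
        then have "column (e, a, b) * column (f, c, g) \<in> ?G"
          using 2 assms abc by (intro low) auto
        then show ?thesis unfolding rot using column_swap12[of c f g] c assms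
          by (simp add: straightening_closed del: column.simps)
      qed
    qed
    show ?thesis
      unfolding column_exchange1[OF abc(3,4) assms(2) e] by (intro straightening_closed 21 22 23)
  next
    case 3
    then have e: "e < n" "f < n" using abc by simp_all
    then have ef: "e < f" using assms by auto
    have "valid (e, f, c)" "valid (a, b, g)" using 3 assms abc ef by auto
    then have 31: "column (e, f, c) * column (a, b, g) \<in> ?G"
      using main 3 by (simp add: min_def max_def del: column.simps)
    have sw: "column (e, b, f) = - column (e, f, b)"
      using e abc triple_swap23[of "v e" "v b" "v f"] by simp
    have 32: "column (e, b, f) * column (a, c, g) \<in> ?G"
    proof (cases "c = g")
      case True
      then have "column (a, c, g) = 0" using assms(2) by (simp add: triple_eq_0 commutator_def)
      then show ?thesis by (simp add: straightening_closed del: column.simps)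
    next
      case False
      then have "column (e, f, b) * column (a, c, g) \<in> ?G"
        using 3 assms abc ef by (intro low) auto
      then show ?thesis unfolding sw by (simp add: straightening_closed del: column.simps)
    qed
    have 33: "column (a, e, f) * column (b, c, g) \<in> ?G"
    proof (cases "a = f \<or> c = g")
      case True
      then have "column (b, c, g) = 0 \<or> column (a, e, f) = 0"
        using assms(2) abc by (auto simp add: triple_eq_0 commutator_def)
      then show ?thesis by (auto simp add: straightening_closed simp del: column.simps)
    next
      case False
      then consider "a < f" | "f < a" by linarith
      then show ?thesis
      proof cases
        case 1
        then have "column (e, a, f) * column (b, c, g) \<in> ?G"
          using 3 False assms abc ef by (intro low) auto
        then show ?thesis unfolding column_swap12[OF abc(3) e(1)] by (simp add: straightening_closed del: column.simps)
      next
        case 2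
        have "column (a, e, f) = column (e, f, a)"
          using e abc triple_rotate[of "v a" "v e" "v f"] by simp
        moreover have "column (e, f, a) * column (b, c, g) \<in> ?G"
          using 2 3 False assms abc ef by (intro low) auto
        ultimately show ?thesis by (simp del: column.simps)
      qed
    qed
    show ?thesis
      unfolding column_exchange2[OF abc(3,4) assms(2) e] by (intro straightening_closed 31 32 33)
  next
    case 4
    then have e: "e < n" "f < n" "e < f" "f < g" using abc assms by auto
    have "valid (a, f, c)" "valid (e, b, g)" using 4 assms abc e by auto
    then have 41: "column (a, f, c) * column (e, b, g) \<in> ?G"
      using main 4 by (simp add: min_def max_def del: column.simps)
    have sw: "column (a, b, f) = - column (a, f, b)"
      using e abc triple_swap23[of "v a" "v b" "v f"] by simp
    have 42: "column (a, b, f) * column (e, c, g) \<in> ?G"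
    proof (cases "c = g")
      case True
      then have "column (e, c, g) = 0" using assms(2) by (simp add: triple_eq_0 commutator_def)
      then show ?thesis by (simp add: straightening_closed del: column.simps)
    next
      case False
      then have "column (a, f, b) * column (e, c, g) \<in> ?G"
        using 4 assms abc e by (intro low) auto
      then show ?thesis unfolding sw by (simp add: straightening_closed del: column.simps)
    qed
    have 43: "column (f, b, c) * column (a, e, g) \<in> ?G"
    proof (cases "a = e")
      case True
      then have "column (a, e, g) = 0" using e by (simp add: triple_eq_0 commutator_def)
      then show ?thesis by (simp add: straightening_closed del: column.simps)
    next
      case False
      then show ?thesis using 4 assms abc e by (intro low) auto
    qed
    \<comment> \<open>The exchange law acts on the head of the second column only, so
      \<open>f\<close> is first swapped with \<open>e\<close>.\<close>
    have "column (a, b, c) * column (f, e, g) = column (f, b, c) * column (a, e, g)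
       + column (a, f, c) * column (b, e, g) + column (a, b, f) * column (c, e, g)"
      by (rule column_exchange1) (use abc e assms in auto)
    moreover have "column (f, e, g) = - column (e, f, g)" "column (b, e, g) = - column (e, b, g)"
      "column (c, e, g) = - column (e, c, g)"
      using abc e assms(2) column_swap12 by blast+
    ultimately have "column (a, b, c) * column (e, f, g) = - (column (f, b, c) * column (a, e, g))
       + column (a, f, c) * column (e, b, g) + column (a, b, f) * column (e, c, g)"
      by (simp add: algebra_simps minus_equation_iff[of "_ * _"] del: column.simps)
    then show ?thesis by (simp only:) (intro straightening_closed 41 42 43)
  qed
qed


section \<open>Products of two columns of length at most two\<close>

lemma column_empty [simp]: "column (NA, NA, NA) = 1"
  by simp

lemma column_central: "valid (a, b, c) \<Longrightarrow> c < n \<Longrightarrow> column (a, b, c) * x = x * column (a, b, c)"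
  by (simp add: triple_central)

text \<open>Two columns of length two weigh at least 12n, whereas a column of length three weighs
  less than 3n and a single vector 9n.\<close>

lemma straightening_cross:
  assumes "b < n" "d < n" "x < n" "y < n" "z < n" "w < n"
  shows "triple (v x) (v y) (v z) * v w \<in> straightening (a, b, NA) (c, d, NA)"
proof (rule straightening_triple)
  fix p q r assume pqr: "p < q" "q < r" "r < n"
  have "column (p, q, r) * column (w, NA, NA) \<in> straightening (a, b, NA) (c, d, NA)"
    using pqr assms by (intro straightening_low) auto
  then show "column (p, q, r) * v w \<in> straightening (a, b, NA) (c, d, NA)" using assms by simp
qed (use assms in auto)

text \<open>Thus columns of length two commute up to terms of smaller weight.\<close>

lemma straightening_commutators:
  assumes "b < n" "d < n" "x < n" "y < n" "z < n" "w < n"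
  shows "commutator (commutator (v x) (v y)) (commutator (v z) (v w)) \<in> straightening (a, b, NA) (c, d, NA)"
  unfolding commutator_commutators[OF skew_v skew_v skew_v skew_v] straightening_double
  by (intro straightening_closed straightening_cross assms)

text \<open>For nested columns neither order of the factors is a tableau. The cyclic relation
  replaces their anticommutator by two others: one pairs \<open>(a, c)\<close> with
  \<open>(d, b)\<close>, whose weight is smaller by d - c, the other pairs the meet
  \<open>(a, d)\<close> with the join \<open>(c, b)\<close>. The commutators that arise on the way
  are of smaller weight.\<close>

lemma straightening_nested:
  assumes "a < c" "c < d" "d < b" "b < n"
  shows "commutator (v a) (v b) * commutator (v c) (v d) \<in> straightening (a, b, NA) (c, d, NA)" (is "_ \<in> ?G")
proof -
  let ?X = "\<lambda>x y. commutator (v x) (v y)"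
  have X: "?X x y = column (x, y, NA)" if "y < n" for x y using that by simp
  have cr: "commutator (?X x y) (?X z w) \<in> ?G" if "x < n" "y < n" "z < n" "w < n" for x y z w
    using assms that by (intro straightening_commutators) auto
  have ca: "?X c a = - ?X a c" and bc: "?X b c = - ?X c b" and bd: "?X b d = - ?X d b"
    by (rule commutator_swap)+
  have "?X a c * ?X d b \<in> ?G" "?X d b * ?X a c \<in> ?G"
    using assms unfolding X[OF assms(4)] X[of c, OF less_trans[OF assms(2) less_trans[OF assms(3,4)]]]
    by (intro straightening_low; auto)+
  then have 1: "anticomm (?X c a) (?X b d) \<in> ?G"
    unfolding anticomm_def ca bd by (simp add: straightening_closed)
  have "column (a, d, NA) * column (c, b, NA) \<in> ?G"
    using assms by (intro straightening_main) auto
  then have ad: "?X a d * ?X c b \<in> ?G" using assms by simp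
  have "anticomm (?X b c) (?X a d) = - (2 * (?X a d * ?X c b) + commutator (?X c b) (?X a d))"
    unfolding bc anticomm_def commutator_def[of "?X c b" "?X a d"] by (simp add: mult_2)
  then have 2: "anticomm (?X b c) (?X a d) \<in> ?G"
    using ad cr assms by (simp add: straightening_closed straightening_double)
  have "2 * (?X a b * ?X c d) = commutator (?X a b) (?X c d) + anticomm (?X a b) (?X c d)"
    by (simp add: anticomm_def commutator_def[of "?X a b"] mult_2)
  also have "anticomm (?X a b) (?X c d) = - (anticomm (?X b c) (?X a d) + anticomm (?X c a) (?X b d))"
    using anticomm_commutators_cyclic[of "v a" "v b" "v c" "v d"] by (simp add: add_eq_0_iff add.assoc)
  finally have "2 * (?X a b * ?X c d) \<in> ?G"
    using 1 2 cr assms by (simp only:) (intro straightening_closed; simp)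
  then show ?thesis by (simp add: straightening_double)
qed

lemma straightening_22:
  assumes "a < b" "b < n" "c < d" "d < n"
  shows "column (a, b, NA) * column (c, d, NA) \<in> straightening (a, b, NA) (c, d, NA)" (is "_ \<in> ?G")
proof -
  have X: "column (x, y, NA) = commutator (v x) (v y)" if "y < n" for x y using that by simp
  have cr: "commutator (column (a, b, NA)) (column (c, d, NA)) \<in> ?G"
    unfolding X[OF assms(2)] X[OF assms(4)] using assms by (intro straightening_commutators) auto
  have sw: "column (a, b, NA) * column (c, d, NA) \<in> ?G"
    if "column (c, d, NA) * column (a, b, NA) \<in> ?G"
    using straightening_closed(2)[OF cr that] by (simp add: commutator_def del: column.simps)
  consider "a \<le> c" "b \<le> d" | "c \<le> a" "d \<le> b" | "a < c" "d < b" | "c < a" "b < d" by linarith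
  then show ?thesis
  proof cases
    case 1
    then show ?thesis using assms by (intro straightening_main) auto
  next
    case 2
    then show ?thesis using assms by (intro sw straightening_main) auto
  next
    case 3
    then show ?thesis unfolding X[OF assms(2)] X[OF assms(4)] using assms by (intro straightening_nested) auto
  next
    case 4
    then show ?thesis unfolding X[OF assms(2)] X[OF assms(4)] straightening_sym[of "(a, b, NA)"]
      using assms sw[unfolded X[OF assms(2)] X[OF assms(4)] straightening_sym[of "(a, b, NA)"]]
      by (intro sw[unfolded X[OF assms(2)] X[OF assms(4)] straightening_sym[of "(a, b, NA)"]] straightening_nested) auto
  qed
qed

lemma straightening_21_triple:
  assumes "a < n" "b < n" "c < n"
  shows "triple (v a) (v b) (v c) \<in> straightening (b, c, NA) (a, NA, NA)"
proof -
  have "triple (v a) (v b) (v c) * 1 \<in> straightening (b, c, NA) (a, NA, NA)"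
  proof (rule straightening_triple)
    fix p q r assume pqr: "p < q" "q < r" "r < n"
    have "column (p, q, r) * column (NA, NA, NA) \<in> straightening (b, c, NA) (a, NA, NA)"
      using pqr assms by (intro straightening_low) auto
    then show "column (p, q, r) * 1 \<in> straightening (b, c, NA) (a, NA, NA)" by simp
  qed (use assms in auto)
  then show ?thesis by simp
qed

text \<open>For \<open>a < b\<close> the relation \<open>jacobi\<close> expresses the product by a
  determinant, the product of meet and join, and the pair \<open>(a, b)\<close>, \<open>c\<close>,
  which is lighter because \<open>b < c\<close>.\<close>

lemma straightening_21:
  assumes "b < c" "c < n" "a < n"
  shows "column (b, c, NA) * column (a, NA, NA) \<in> straightening (b, c, NA) (a, NA, NA)" (is "_ \<in> ?G")
proof (cases "b \<le> a")
  case True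
  then show ?thesis using assms by (intro straightening_main) auto
next
  case False
  let ?X = "\<lambda>x y. commutator (v x) (v y)"
  have "column (a, c, NA) * column (b, NA, NA) \<in> ?G"
    using assms False by (intro straightening_main) auto
  moreover have "column (a, b, NA) * column (c, NA, NA) \<in> ?G"
    using assms False by (intro straightening_low) auto
  ultimately have 1: "?X a c * v b \<in> ?G" "?X a b * v c \<in> ?G" using assms by simp_all
  have "2 * (?X b c * v a) = 3 * triple (v a) (v b) (v c) - 2 * (?X c a * v b) - 2 * (?X a b * v c)"
    using jacobi[of "v a" "v b" "v c"] by (simp add: algebra_simps)
  also have "?X c a = - ?X a c" by (rule commutator_swap)
  finally have "2 * (?X b c * v a) = 3 * triple (v a) (v b) (v c) + 2 * (?X a c * v b) - 2 * (?X a b * v c)"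
    by simp
  moreover have "3 * triple (v a) (v b) (v c) \<in> ?G"
    unfolding mult_3 using assms by (intro straightening_closed straightening_21_triple) auto
  ultimately have "2 * (?X b c * v a) \<in> ?G" using 1 by (simp add: straightening_closed straightening_double)
  then show ?thesis using assms by (simp add: straightening_double)
qed

lemma straightening_12:
  assumes "b < c" "c < n" "a < n"
  shows "column (a, NA, NA) * column (b, c, NA) \<in> straightening (a, NA, NA) (b, c, NA)"
proof -
  have "v a * commutator (v b) (v c) = triple (v a) (v b) (v c) - commutator (v b) (v c) * v a"
    by (simp add: triple_def anticomm_def)
  moreover have "commutator (v b) (v c) * v a \<in> straightening (b, c, NA) (a, NA, NA)"
    using straightening_21[OF assms] assms by simp
  ultimately have "v a * commutator (v b) (v c) \<in> straightening (b, c, NA) (a, NA, NA)"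
    using assms by (simp add: straightening_closed straightening_21_triple)
  then show ?thesis unfolding straightening_sym[of "(a, NA, NA)"] using assms by simp
qed

lemma straightening_11:
  assumes "a < n" "b < n"
  shows "column (a, NA, NA) * column (b, NA, NA) \<in> straightening (a, NA, NA) (b, NA, NA)" (is "_ \<in> ?G")
proof (cases "a \<le> b")
  case True
  then show ?thesis using assms by (intro straightening_main) auto
next
  case False
  have "column (b, NA, NA) * column (a, NA, NA) \<in> ?G"
    using assms False by (intro straightening_main) auto
  \<comment> \<open>Two vectors merge into one column here; an empty column keeps the number of
    columns at two.\<close>
  moreover have "column (b, a, NA) * column (NA, NA, NA) \<in> ?G"
    using assms False by (intro straightening_low) auto
  ultimately have "v b * v a - commutator (v b) (v a) \<in> ?G" using assms by (simp add: straightening_closed)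
  then show ?thesis using assms by (simp add: commutator_def)
qed

lemma valid_cases:
  assumes "valid C"
  obtains (empty) "C = (NA, NA, NA)" | (one) a where "C = (a, NA, NA)" "a < n"
    | (two) a b where "C = (a, b, NA)" "a < b" "b < n"
    | (three) a b c where "C = (a, b, c)" "a < b" "b < c" "c < n"
  using assms by (cases C) auto

text \<open>Columns of length zero and three are central, so they can be placed on whichever side
  makes the last row ordered. Only lengths one and two need the separate laws.\<close>

lemma column_mult_straightening:
  assumes "valid C" "valid D"
  shows "column C * column D \<in> straightening C D"
proof -
  have three: "column (a, b, c) * column D' \<in> straightening (a, b, c) D'"
    if "valid (a, b, c)" "c < n" "valid D'" for a b c D'
  proof -
    obtain e f g where D': "D' = (e, f, g)" by (cases D')
    show ?thesis
    proof (cases "c \<le> g")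
      case True
      then show ?thesis using straightening_triple_column that D' by blast
    next
      case False
      then have "column D' * column (a, b, c) \<in> straightening D' (a, b, c)"
        using straightening_triple_column[of e f g a b c] that D' by simp
      then show ?thesis using that column_central straightening_sym by metis
    qed
  qed
  have empty: "column (NA, NA, NA) * column D' \<in> straightening (NA, NA, NA) D'" if "valid D'" for D'
  proof -
    have "column D' * column (NA, NA, NA) \<in> straightening (NA, NA, NA) D'"
      using that by (cases D', intro straightening_main) auto
    then show ?thesis by simp
  qed
  have comm: "column C' * x = x * column C'" if "valid C'" "C' = (NA, NA, NA) \<or> snd (snd C') < n" for C' x
    using that(2)
  proof
    assume "C' = (NA, NA, NA)"
    then show ?thesis by simp
  next
    assume "snd (snd C') < n"
    then show ?thesis using that(1) column_central by (metis prod.collapse)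
  qed
  have left: "column C' * column D' \<in> straightening C' D'"
    if "valid C'" "valid D'" "C' = (NA, NA, NA) \<or> snd (snd C') < n" for C' D'
    using that(3)
  proof
    assume "C' = (NA, NA, NA)"
    then show ?thesis using empty that(2) by (simp only:)
  next
    assume "snd (snd C') < n"
    then show ?thesis using that(1,2) three by (metis prod.collapse)
  qed
  have right: "column D' * column C' \<in> straightening D' C'"
    if "valid C'" "valid D'" "C' = (NA, NA, NA) \<or> snd (snd C') < n" for C' D'
    using left[OF that] unfolding comm[OF that(1,3), of "column D'"] straightening_sym[of C' D'] .
  show ?thesis using assms(1)
  proof (cases rule: valid_cases)
    case C: (one a)
    show ?thesis using assms(2)
    proof (cases rule: valid_cases)
      case (one b)
      then show ?thesis using straightening_11 C by blast
    next
      case (two b c)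
      then show ?thesis using straightening_12 C by blast
    next
      case empty
      then show ?thesis by (intro right assms disjI1)
    next
      case (three a b c)
      then show ?thesis by (intro right assms disjI2) simp
    qed
  next
    case C: (two a b)
    show ?thesis using assms(2)
    proof (cases rule: valid_cases)
      case (one c)
      then show ?thesis using straightening_21 C by blast
    next
      case (two c d)
      then show ?thesis using straightening_22 C by blast
    next
      case empty
      then show ?thesis by (intro right assms disjI1)
    next
      case (three a b c)
      then show ?thesis by (intro right assms disjI2) simp
    qed
  next
    case empty
    then show ?thesis by (intro left assms disjI1)
  next
    case (three a b c)
    then show ?thesis by (intro left assms disjI2) simp
  qed
qed

section \<open>Termination of straightening\<close>

fun column_le :: "nat \<times> nat \<times> nat \<Rightarrow> nat \<times> nat \<times> nat \<Rightarrow> bool" where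
  "column_le (a, b, c) (e, f, g) \<longleftrightarrow> a \<le> e \<and> b \<le> f \<and> c \<le> g"

text \<open>Earlier columns count with a larger factor, so moving small entries forward lowers the
  value while the total of all entries stays the same.\<close>

fun disorder :: "(nat \<times> nat \<times> nat) list \<Rightarrow> nat" where
  "disorder [] = 0"
| "disorder ((a, b, c) # T) = Suc (length T) * (a + b + c) + disorder T"

lemma disorder_append:
  "length S = length S' \<Longrightarrow> disorder S < disorder S' \<Longrightarrow> disorder (A @ S) < disorder (A @ S')"
  by (induction A) auto

lemma disorder_meet_join:
  assumes "\<not> column_le C D"
  shows "disorder (meet C D # join C D # B) < disorder (C # D # B)"
proof -
  obtain a b c e f g where [simp]: "C = (a, b, c)" "D = (e, f, g)" by (cases C; cases D)
  define s where "s = min a e + min b f + min c g"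
  define t where "t = max a e + max b f + max c g"
  have "s + t = (a + b + c) + (e + f + g)" by (simp add: s_def t_def)
  moreover have "s < a + b + c" using assms by (auto simp: s_def min_def)
  ultimately have "Suc (length B) * (s + t) + s < Suc (length B) * ((a + b + c) + (e + f + g)) + (a + b + c)"
    by (simp only: )
  then show ?thesis by (simp add: s_def t_def algebra_simps)
qed

lemma not_chain_split:
  "\<not> sorted_wrt column_le T \<Longrightarrow> \<exists>A C D B. T = A @ C # D # B \<and> \<not> column_le C D"
proof (induction T)
  case (Cons C T)
  show ?case
  proof (cases "sorted_wrt column_le T")
    case False
    then show ?thesis using Cons.IH by (metis append_Cons)
  next
    case True
    with Cons.prems obtain E where E: "E \<in> set T" "\<not> column_le C E" by auto
    then obtain D B where T: "T = D # B" by (cases T) auto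
    have "column_le D E \<or> E = D" using True E T by auto
    then have "\<not> column_le C D" using E by (cases C; cases D; cases E) auto
    then show ?thesis using T by (metis append_Nil)
  qed
qed simp

text \<open>The length is a parameter because rewriting preserves the number of columns. Empty
  columns evaluate to 1 and are discarded only at the end.\<close>

definition straight :: "nat \<Rightarrow> 'a set" where
  "straight r = {prod_list (map column T) | T. length T = r \<and> (\<forall>C\<in>set T. valid C) \<and> sorted_wrt column_le T}"

lemma span_sandwich:
  assumes "x \<in> span S" "\<And>s. s \<in> S \<Longrightarrow> u * s * w \<in> span Z"
  shows "u * x * w \<in> span (Z :: 'a set)"
  using assms(1)
proof (induction rule: span_induct_alt)
  case base
  show ?case by (simp add: span_zero)
next
  case (step c s y)
  then have "u * (c *\<^sub>R s + y) * w = c *\<^sub>R (u * s * w) + u * y * w"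
    by (simp add: algebra_simps)
  then show ?case using step assms(2) by (metis span_add span_scale)
qed

text \<open>Lexicographic induction on total weight and disorder: correction terms lower the weight,
  while the term with meet and join keeps it and lowers \<open>disorder\<close>.\<close>

lemma prod_list_columns_straight:
  "(\<forall>C\<in>set T. valid C) \<Longrightarrow> prod_list (map column T) \<in> span (straight (length T))"
proof (induction T rule: wf_induct[OF wf_measures[of "[\<lambda>T. sum_list (map column_weight T), disorder]"]])
  case (1 T)
  show ?case
  proof (cases "sorted_wrt column_le T")
    case True
    then show ?thesis using 1 by (intro span_base) (auto simp: straight_def)
  next
    case False
    then obtain A C D B where T: "T = A @ C # D # B" "\<not> column_le C D" using not_chain_split by blast
    have *: "prod_list (map column A) * (column C' * column D') * prod_list (map column B)
        \<in> span (straight (length T))"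
      if CD: "valid C'" "valid D'" "column_weight C' + column_weight D' < column_weight C + column_weight D \<or> C' = meet C D \<and> D' = join C D" for C' D'
    proof -
      let ?T = "A @ C' # D' # B"
      have "(?T, T) \<in> measures [\<lambda>T. sum_list (map column_weight T), disorder]"
      proof (cases "column_weight C' + column_weight D' < column_weight C + column_weight D")
        case True
        then show ?thesis using T by simp
      next
        case False
        then have e: "C' = meet C D" "D' = join C D" using CD by auto
        have "column_weight C' + column_weight D' = column_weight C + column_weight D" unfolding e by (cases C; cases D) auto
        moreover have "disorder ?T < disorder T"
          unfolding T(1) e by (intro disorder_append disorder_meet_join T(2)) auto
        ultimately show ?thesis using T by simp
      qed
      moreover have "\<forall>C\<in>set ?T. valid C" using 1(2) CD T by auto
      ultimately have "prod_list (map column ?T) \<in> span (straight (length ?T))"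
        using 1(1) by blast
      moreover have "length ?T = length T" using T by simp
      ultimately show ?thesis by (simp add: mult.assoc)
    qed
    have "prod_list (map column A) * (column C * column D) * prod_list (map column B)
        \<in> span (straight (length T))"
    proof (rule span_sandwich)
      show "column C * column D \<in> span {column C' * column D' | C' D'. valid C' \<and> valid D' \<and>
          (column_weight C' + column_weight D' < column_weight C + column_weight D \<or> C' = meet C D \<and> D' = join C D)}"
        using column_mult_straightening[of C D] 1 T unfolding straightening_def by simp
    qed (use * in blast)
    then show ?thesis using T by (simp add: mult.assoc)
  qed
qed

text \<open>Without empty columns the first row contains no padding, so its length can be read off
  from exponents.\<close>

definition proper :: "(nat \<times> nat \<times> nat) list \<Rightarrow> bool" where
  "proper T \<longleftrightarrow> (\<forall>C\<in>set T. valid C \<and> C \<noteq> (NA, NA, NA)) \<and> sorted_wrt column_le T"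

lemma straight_proper:
  "x \<in> straight r \<Longrightarrow> \<exists>T. proper T \<and> x = prod_list (map column T)"
proof -
  assume "x \<in> straight r"
  then obtain T where T: "\<forall>C\<in>set T. valid C" "sorted_wrt column_le T" "x = prod_list (map column T)"
    by (auto simp: straight_def)
  have "prod_list (map column (filter (\<lambda>C. C \<noteq> (NA, NA, NA)) T)) = prod_list (map column T)" for T
    by (induction T) (auto simp del: column.simps)
  moreover have "proper (filter (\<lambda>C. C \<noteq> (NA, NA, NA)) T)"
    using T by (auto simp: proper_def intro: sorted_wrt_filter simp del: valid.simps)
  ultimately show ?thesis using T by metis
qed

end

section \<open>Standard monomials with central trace factors\<close>

locale skew_columns_traces = skew_columns +
  fixes t :: "nat \<Rightarrow> 'a"
  assumes t_central: "t i * x = x * t i"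
begin

definition monomial :: "nat list \<Rightarrow> (nat \<times> nat \<times> nat) list \<Rightarrow> 'a" where
  "monomial us T = prod_list (map t us) * prod_list (map column T)"

definition standard_monomials :: "'a set" where
  "standard_monomials = {monomial us T | us T. sorted us \<and> set us \<subseteq> {..<n} \<and> proper T}"

lemma prod_list_t_central: "prod_list (map t us) * x = x * prod_list (map t us)"
proof (induction us)
  case (Cons i us)
  have "prod_list (map t (i # us)) * x = t i * (prod_list (map t us) * x)" by (simp add: mult.assoc)
  also have "\<dots> = t i * x * prod_list (map t us)" unfolding Cons by (simp add: mult.assoc)
  also have "\<dots> = x * prod_list (map t (i # us))" unfolding t_central[of i x] by (simp add: mult.assoc)
  finally show ?case .
qed simp

lemma prod_list_t_insort: "prod_list (map t (insort i us)) = t i * prod_list (map t us)"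
proof (induction us)
  case (Cons j us)
  then show ?case using t_central[of i "t j"] by (simp flip: mult.assoc)
qed simp

lemma span_standard_t:
  assumes "i < n" "x \<in> span standard_monomials"
  shows "t i * x \<in> span standard_monomials"
proof -
  have "t i * x * 1 \<in> span standard_monomials" using assms(2)
  proof (rule span_sandwich)
    fix s assume "s \<in> standard_monomials"
    then obtain us T where s: "s = monomial us T" "sorted us" "set us \<subseteq> {..<n}" "proper T"
      by (auto simp: standard_monomials_def)
    then have "monomial (insort i us) T \<in> standard_monomials"
      using assms(1) by (auto simp: standard_monomials_def sorted_insort set_insort_key intro!: exI)
    then show "t i * s * 1 \<in> span standard_monomials"
      using s by (simp add: monomial_def prod_list_t_insort mult.assoc span_base)
  qed
  then show ?thesis by simp
qed

text \<open>The vector passes the central traces and becomes a new column of length one in front of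
  the tableau, which is then straightened.\<close>

lemma span_standard_v:
  assumes "i < n" "x \<in> span standard_monomials"
  shows "v i * x \<in> span standard_monomials"
proof -
  have "v i * x * 1 \<in> span standard_monomials" using assms(2)
  proof (rule span_sandwich)
    fix s assume "s \<in> standard_monomials"
    then obtain us T where s: "s = monomial us T" "sorted us" "set us \<subseteq> {..<n}" "proper T"
      by (auto simp: standard_monomials_def)
    let ?T = "(i, NA, NA) # T"
    have "prod_list (map column ?T) \<in> span (straight (length ?T))"
      using s assms(1) by (intro prod_list_columns_straight) (auto simp: proper_def simp del: valid.simps, simp)
    then have "prod_list (map t us) * prod_list (map column ?T) * 1 \<in> span standard_monomials"
    proof (rule span_sandwich)
      fix y assume "y \<in> straight (length ?T)"
      then obtain T' where "proper T'" "y = prod_list (map column T')" using straight_proper by blast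
      then have "prod_list (map t us) * y \<in> standard_monomials" using s by (auto simp: standard_monomials_def monomial_def)
      then show "prod_list (map t us) * y * 1 \<in> span standard_monomials" by (simp add: span_base)
    qed
    also have "prod_list (map t us) * prod_list (map column ?T) * 1 = v i * s * 1"
      using assms(1) by (simp add: s monomial_def prod_list_t_central[of us "v i", symmetric] flip: mult.assoc)
    finally show "v i * s * 1 \<in> span standard_monomials" .
  qed
  then show ?thesis by simp
qed

lemma one_standard: "1 \<in> standard_monomials"
  unfolding standard_monomials_def by (auto simp: monomial_def proper_def intro!: exI[of _ "[]"])

end

section \<open>The quotient by the trace ideal\<close>

definition trace_ideal :: "'n qpoly set" where
  "trace_ideal = star_ideal_generated {commutator (word_poly w + star (word_poly w)) (q i) | w i. True}"

lemma star_ideal_trace_ideal: "star_ideal (trace_ideal :: 'n qpoly set)"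
  unfolding trace_ideal_def star_ideal_generated_def star_ideal_def by blast

lemma trace_ideal_closed:
  "(0 :: 'n qpoly) \<in> trace_ideal"
  "a \<in> trace_ideal \<Longrightarrow> b \<in> trace_ideal \<Longrightarrow> a + b \<in> (trace_ideal :: 'n qpoly set)"
  "a \<in> trace_ideal \<Longrightarrow> r * a \<in> (trace_ideal :: 'n qpoly set)"
  "a \<in> trace_ideal \<Longrightarrow> a * r \<in> (trace_ideal :: 'n qpoly set)"
  "a \<in> trace_ideal \<Longrightarrow> star a \<in> (trace_ideal :: 'n qpoly set)"
  using star_ideal_trace_ideal[where 'n = 'n] unfolding star_ideal_def by blast+

lemma trace_ideal_uminus: "a \<in> trace_ideal \<Longrightarrow> - a \<in> (trace_ideal :: 'n qpoly set)"
  using trace_ideal_closed(3)[of a "- 1"] by simp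

lemma trace_ideal_diff:
  "a \<in> trace_ideal \<Longrightarrow> b \<in> trace_ideal \<Longrightarrow> a - b \<in> (trace_ideal :: 'n qpoly set)"
  using trace_ideal_closed(2)[of a "- b"] trace_ideal_uminus[of b] by simp

lemma generator_in_trace_ideal:
  "commutator (word_poly w + star (word_poly w)) (q i) \<in> trace_ideal"
  unfolding trace_ideal_def star_ideal_generated_def by blast

section \<open>The easy inclusion: the trace ideal lies in the kernel\<close>

lemma hpoly_trace_central: "(h + hcnj h) * p = p * (h + hcnj h)" for h :: "'n hpoly"
proof (induction h rule: poly_mapping_single_induct)
  case (single k c)
  have "c + quat_cnj c = quat_of_real (2 * qre c)"
    by (simp add: quat_cnj_def plus_quat_def quat_of_real_def)
  then have "Poly_Mapping.single k c + hcnj (Poly_Mapping.single k c)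
      = Poly_Mapping.single k (quat_of_real (2 * qre c))"
    by (simp flip: single_add)
  then show ?case by (simp only: hpoly_real_central)
next
  case (add a b)
  have "a + b + hcnj (a + b) = (a + hcnj a) + (b + hcnj b)" by simp
  then show ?case using add by (simp only: distrib_left distrib_right)
qed

lemma rho_diff: "rho (a - b) = rho a - rho b"
  using rho_add[of "a - b" b] by simp

lemma star_ideal_kernel: "star_ideal {p. rho p = 0}"
  unfolding star_ideal_def by (simp add: rho_mult rho_star) (simp add: rho_def)

lemma trace_ideal_subset_kernel: "trace_ideal \<subseteq> {p :: 'n qpoly. rho p = 0}"
proof -
  have "rho (commutator (word_poly w + star (word_poly w)) (q i)) = 0"
    for w :: "'n qword" and i
    by (simp add: commutator_def rho_diff rho_mult rho_star hpoly_trace_central)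
  then show ?thesis
    unfolding trace_ideal_def star_ideal_generated_def
    by (intro Inter_lower) (auto simp: star_ideal_kernel)
qed

lemma qpoly_scalar_central: "Poly_Mapping.single 0 r * p = p * (Poly_Mapping.single 0 r :: 'n qpoly)"
  by (induction p rule: poly_mapping_single_induct) (simp_all add: mult_single algebra_simps)

\<comment> \<open>As a type the quotient can be made a \<open>real_algebra_1\<close>, so that the
  locales above and linear spans apply to it.\<close>
quotient_type 'n qalg = "'n qpoly" / "\<lambda>p r. p - r \<in> trace_ideal"
proof (rule equivpI)
  show "reflp (\<lambda>p r. p - r \<in> (trace_ideal :: 'n qpoly set))"
    by (simp add: reflp_def trace_ideal_closed)
  show "symp (\<lambda>p r. p - r \<in> (trace_ideal :: 'n qpoly set))"
    unfolding symp_def using trace_ideal_uminus by (metis minus_diff_eq)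
  show "transp (\<lambda>p r. p - r \<in> (trace_ideal :: 'n qpoly set))"
    unfolding transp_def using trace_ideal_closed(2) by (metis diff_add_cancel add_diff_eq)
qed

instantiation qalg :: (type) real_algebra_1
begin

lift_definition zero_qalg :: "'a qalg" is 0 .
lift_definition one_qalg :: "'a qalg" is 1 .
lift_definition plus_qalg :: "'a qalg \<Rightarrow> 'a qalg \<Rightarrow> 'a qalg" is "(+)"
  using trace_ideal_closed(2) by (metis add_diff_add)
lift_definition uminus_qalg :: "'a qalg \<Rightarrow> 'a qalg" is uminus
  using trace_ideal_uminus by (metis minus_diff_minus)
lift_definition minus_qalg :: "'a qalg \<Rightarrow> 'a qalg \<Rightarrow> 'a qalg" is "(-)"
proof -
  fix a b c d :: "'a qpoly"
  assume "a - b \<in> trace_ideal" "c - d \<in> trace_ideal"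
  then have "(a - b) - (c - d) \<in> trace_ideal" by (rule trace_ideal_diff)
  then show "a - c - (b - d) \<in> trace_ideal" by (simp add: algebra_simps)
qed
lift_definition times_qalg :: "'a qalg \<Rightarrow> 'a qalg \<Rightarrow> 'a qalg" is "(*)"
proof -
  fix a b c d :: "'a qpoly"
  assume "a - b \<in> trace_ideal" "c - d \<in> trace_ideal"
  then have "(a - b) * c + b * (c - d) \<in> trace_ideal" by (intro trace_ideal_closed)
  then show "a * c - b * d \<in> trace_ideal" by (simp add: algebra_simps)
qed
lift_definition scaleR_qalg :: "real \<Rightarrow> 'a qalg \<Rightarrow> 'a qalg" is
  "\<lambda>r p. Poly_Mapping.single 0 r * p"
  using trace_ideal_closed(3) by (metis right_diff_distrib)

instance
proof
  fix a b c :: "'a qalg" and r s :: real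
  show "a + b + c = a + (b + c)" by transfer (simp add: trace_ideal_closed add.assoc)
  show "a + b = b + a" by transfer (simp add: trace_ideal_closed)
  show "0 + a = a" by transfer (simp add: trace_ideal_closed)
  show "- a + a = 0" by transfer (simp add: trace_ideal_closed)
  show "a - b = a + - b" by transfer (simp add: trace_ideal_closed)
  show "a * b * c = a * (b * c)" by transfer (simp add: trace_ideal_closed mult.assoc)
  show "1 * a = a" "a * 1 = a" by (transfer; simp add: trace_ideal_closed)+
  show "(a + b) * c = a * c + b * c" by transfer (simp add: trace_ideal_closed distrib_right)
  show "a * (b + c) = a * b + a * c" by transfer (simp add: trace_ideal_closed distrib_left)
  show "r *\<^sub>R (a + b) = r *\<^sub>R a + r *\<^sub>R b" by transfer (simp add: trace_ideal_closed distrib_left)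
  show "(r + s) *\<^sub>R a = r *\<^sub>R a + s *\<^sub>R a"
    by transfer (simp add: trace_ideal_closed distrib_right single_add)
  show "r *\<^sub>R s *\<^sub>R a = (r * s) *\<^sub>R a"
    by transfer (simp add: trace_ideal_closed mult_single flip: mult.assoc)
  show "1 *\<^sub>R a = a" by transfer (simp add: trace_ideal_closed)
  show "r *\<^sub>R a * b = r *\<^sub>R (a * b)" by transfer (simp add: trace_ideal_closed mult.assoc)
  show "a * r *\<^sub>R b = r *\<^sub>R (a * b)"
  proof (transfer)
    fix a b :: "'a qpoly" and r :: real
    have "a * (Poly_Mapping.single 0 r * b) = Poly_Mapping.single 0 r * (a * b)"
      using qpoly_scalar_central[of r a] by (simp flip: mult.assoc)
    then show "a * (Poly_Mapping.single 0 r * b) - Poly_Mapping.single 0 r * (a * b) \<in> trace_ideal"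
      by (simp add: trace_ideal_closed)
  qed
  \<comment> \<open>The quotient is nonzero because \<open>rho\<close> vanishes on the ideal but not
    at 1.\<close>
  show "(0 :: 'a qalg) \<noteq> 1"
  proof (transfer, rule notI)
    assume "(0 - 1 :: 'a qpoly) \<in> trace_ideal"
    then have "rho (0 - 1 :: 'a qpoly) = 0" using trace_ideal_subset_kernel by blast
    moreover have "rho (0 :: 'a qpoly) = 0" by (simp add: rho_def)
    ultimately show False using rho_one[where 'a = 'a] by (simp only: rho_diff) simp
  qed
qed

end

lift_definition qalg_star :: "'n qalg \<Rightarrow> 'n qalg" is star
proof -
  fix a b :: "'n qpoly"
  assume "a - b \<in> trace_ideal"
  then have "star (a - b) \<in> trace_ideal" by (rule trace_ideal_closed)
  moreover have "star (a - b) + star b = star a" by (simp flip: star_add)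
  ultimately show "star a - star b \<in> trace_ideal" by (metis add_diff_cancel_right')
qed

lift_definition qalg_rho :: "'n qalg \<Rightarrow> 'n hpoly" is rho
proof -
  fix a b :: "'n qpoly"
  assume "a - b \<in> trace_ideal"
  then have "rho (a - b) = 0" using trace_ideal_subset_kernel by blast
  then show "rho a = rho b" by (simp add: rho_diff)
qed

abbreviation "qalg_of \<equiv> abs_qalg"

lemma qalg_of_simps:
  "qalg_of (a + b) = qalg_of a + qalg_of b" "qalg_of (a * b) = qalg_of a * qalg_of b"
  "qalg_of 1 = 1" "qalg_of (star a) = qalg_star (qalg_of a)"
  by (simp_all add: plus_qalg.abs_eq times_qalg.abs_eq one_qalg_def qalg_star.abs_eq)

lemma qalg_of_single: "qalg_of (Poly_Mapping.single w r) = r *\<^sub>R qalg_of (word_poly w)"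
  by (simp add: scaleR_qalg.abs_eq word_poly_def mult_single)

lemma qalg_of_eq_iff: "qalg_of p = qalg_of r \<longleftrightarrow> p - r \<in> trace_ideal"
  by (rule qalg.abs_eq_iff)

lemma qalg_of_eq_0_iff: "qalg_of p = 0 \<longleftrightarrow> p \<in> trace_ideal"
  by (simp add: zero_qalg_def qalg_of_eq_iff)

lemma qalg_of_surj: "\<exists>p. x = qalg_of p"
  by (induction x rule: qalg.abs_induct) blast

lemma qalg_rho_simps:
  "qalg_rho (a + b) = qalg_rho a + qalg_rho b" "qalg_rho (a * b) = qalg_rho a * qalg_rho b"
  "qalg_rho 1 = 1" "qalg_rho 0 = 0" "qalg_rho (a - b) = qalg_rho a - qalg_rho b"
  "qalg_rho (r *\<^sub>R a) = hconst (quat_of_real r) * qalg_rho a"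
proof -
  obtain x y where "a = qalg_of x" "b = qalg_of y" using qalg_of_surj by blast
  then show "qalg_rho (a + b) = qalg_rho a + qalg_rho b" "qalg_rho (a * b) = qalg_rho a * qalg_rho b"
    "qalg_rho 1 = 1" "qalg_rho 0 = 0" "qalg_rho (a - b) = qalg_rho a - qalg_rho b"
    "qalg_rho (r *\<^sub>R a) = hconst (quat_of_real r) * qalg_rho a"
    by (simp_all add: plus_qalg.abs_eq times_qalg.abs_eq minus_qalg.abs_eq scaleR_qalg.abs_eq one_qalg_def
        zero_qalg_def qalg_rho.abs_eq rho_mult rho_one rho_diff) (simp add: rho_def)
qed

section \<open>Centrality of traces in the quotient\<close>

definition qalg_letter :: "'n letter \<Rightarrow> 'n qalg" where
  "qalg_letter l = qalg_of (word_poly (letter_word l))"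

lemma qalg_star_letter: "qalg_star (qalg_letter l) = qalg_letter (bar l)"
  by (simp add: qalg_letter_def word_poly_def flip: qalg_of_simps)

lemma qword_induct [case_names zero plus]:
  fixes P :: "'n qword \<Rightarrow> bool"
  assumes "P 0" "\<And>l w. P w \<Longrightarrow> P (letter_word l + w)"
  shows "P w"
proof -
  have "P (abs_qword u)" for u
  proof (induction u)
    case Nil
    then show ?case using assms(1) by (simp add: zero_qword_def)
  next
    case (Cons l u)
    have "abs_qword (l # u) = letter_word l + abs_qword u"
      by (simp add: letter_word.abs_eq plus_qword.abs_eq)
    then show ?case using assms(2) Cons by simp
  qed
  then show ?thesis by (induction w rule: qword.abs_induct) blast
qed

lemma word_poly_plus: "word_poly (u + w) = word_poly u * word_poly w"
  by (simp add: word_poly_def mult_single)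

lemma qalg_induct [consumes 0, case_names one letter add scale]:
  assumes "P 1" "\<And>l x. P x \<Longrightarrow> P (qalg_letter l * x)"
    "\<And>x y. P x \<Longrightarrow> P y \<Longrightarrow> P (x + y)" "\<And>r x. P x \<Longrightarrow> P (r *\<^sub>R x)"
  shows "P (x :: 'n qalg)"
proof -
  have w: "P (qalg_of (word_poly w))" for w
  proof (induction w rule: qword_induct)
    case zero
    then show ?case using assms(1) by (simp add: word_poly_def qalg_of_simps)
  next
    case (plus l w)
    then show ?case using assms(2) by (simp add: word_poly_plus qalg_of_simps qalg_letter_def)
  qed
  obtain p where "x = qalg_of p" using qalg_of_surj[of x] by (elim exE)
  moreover have "P (qalg_of p)" for p
  proof (induction p rule: poly_mapping_single_induct)
    case (single w r)
    show ?case using w assms(4) by (simp add: qalg_of_single)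
  qed (use assms(3) in \<open>simp add: qalg_of_simps\<close>)
  ultimately show ?thesis by simp
qed

text \<open>The generators give commutation with \<open>q i\<close> only. The trace of a word is
  self-adjoint, so applying \<open>star\<close> to a generator gives commutation with
  \<open>star (q i)\<close>; closure of the ideal under \<open>star\<close> enters here.\<close>

lemma qalg_trace_commutes_letter:
  "(qalg_of (word_poly w) + qalg_star (qalg_of (word_poly w))) * qalg_letter l
    = qalg_letter l * (qalg_of (word_poly w) + qalg_star (qalg_of (word_poly w)))"
proof -
  let ?s = "word_poly w + star (word_poly w)"
  have "?s * q i - q i * ?s \<in> trace_ideal" for i
    using generator_in_trace_ideal by (simp add: commutator_def)
  then have Qs: "qalg_of (?s * q i) = qalg_of (q i * ?s)" for i
    by (simp add: qalg_of_eq_iff)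
  have "star (?s * q i - q i * ?s) \<in> trace_ideal" for i
    using generator_in_trace_ideal by (intro trace_ideal_closed) (simp add: commutator_def)
  moreover have "star (a - b) = star a - star b" for a b :: "'a qpoly"
    by (metis add_diff_cancel_right' diff_add_cancel star_add)
  ultimately have "star (q i) * ?s - ?s * star (q i) \<in> trace_ideal" for i
    by (simp add: star_mult star_star add.commute)
  then have Qb: "qalg_of (star (q i) * ?s) = qalg_of (?s * star (q i))" for i
    by (simp add: qalg_of_eq_iff)
  show ?thesis
  proof (cases l)
    case (Q i)
    have l: "qalg_letter l = qalg_of (q i)" by (simp add: Q qalg_letter_def q_def)
    show ?thesis unfolding l using Qs[of i] by (simp only: qalg_of_simps)
  next
    case (Qbar i)
    have l: "qalg_letter l = qalg_of (star (q i))"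
      by (simp add: Qbar qalg_letter_def q_def word_poly_def)
    show ?thesis unfolding l using Qb[of i] by (simp only: qalg_of_simps)
  qed
qed

lemma qalg_trace_commutes_letter':
  "(x + qalg_star x) * qalg_letter l = qalg_letter l * (x + qalg_star x)"
proof -
  obtain p where p: "x = qalg_of p" using qalg_of_surj[of x] by (elim exE)
  have "(qalg_of p + qalg_star (qalg_of p)) * qalg_letter l = qalg_letter l * (qalg_of p + qalg_star (qalg_of p))"
  proof (induction p rule: poly_mapping_single_induct)
    case (single w r)
    have "qalg_star (qalg_of (Poly_Mapping.single w r)) = r *\<^sub>R qalg_star (qalg_of (word_poly w))"
      using qalg_of_single[of "word_star w" r] by (simp add: word_poly_def flip: qalg_of_simps)
    then have "qalg_of (Poly_Mapping.single w r) + qalg_star (qalg_of (Poly_Mapping.single w r))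
        = r *\<^sub>R (qalg_of (word_poly w) + qalg_star (qalg_of (word_poly w)))"
      by (simp only: qalg_of_single scaleR_right_distrib)
    then show ?case using qalg_trace_commutes_letter[of w l] by simp
  next
    case (add a b)
    have "qalg_of (a + b) + qalg_star (qalg_of (a + b))
        = (qalg_of a + qalg_star (qalg_of a)) + (qalg_of b + qalg_star (qalg_of b))"
      by (simp add: algebra_simps flip: qalg_of_simps)
    then show ?case using add by (simp only: distrib_left distrib_right)
  qed
  then show ?thesis using p by simp
qed

lemma central_trace_qalg_star: "central_trace (qalg_star :: 'n qalg \<Rightarrow> 'n qalg)"
proof
  show "qalg_star (a + b) = qalg_star a + qalg_star b" for a b :: "'n qalg"
    by transfer (simp add: trace_ideal_closed)
  show "qalg_star (a * b) = qalg_star b * qalg_star a" for a b :: "'n qalg"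
    by transfer (simp add: trace_ideal_closed star_mult)
  show "(a + qalg_star a) * b = b * (a + qalg_star a)" for a b :: "'n qalg"
  proof (induction b rule: qalg_induct)
    case (letter l x)
    then show ?case using qalg_trace_commutes_letter'[of a l] by (metis mult.assoc)
  qed (simp_all add: distrib_left distrib_right scaleR_right_distrib)
qed

section \<open>Leading monomials of quaternionic polynomials\<close>

abbreviation xexp :: "'n \<Rightarrow> 4 \<Rightarrow> ('n \<times> 4) \<Rightarrow>\<^sub>0 nat" where
  "xexp i j \<equiv> Poly_Mapping.single (i, j) 1"

lemma lookup_hconst_mult: "Poly_Mapping.lookup (hconst c * p) k = c * Poly_Mapping.lookup p k"
  by (induction p rule: poly_mapping_single_induct)
     (simp_all add: hconst_def mult_single lookup_single when_def lookup_add distrib_left)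

locale graded_exponents =
  fixes variable_weight :: "'n::finite \<times> 4 \<Rightarrow> nat"
begin

definition weight :: "(('n \<times> 4) \<Rightarrow>\<^sub>0 nat) \<Rightarrow> nat" where
  "weight e = (\<Sum>x\<in>UNIV. Poly_Mapping.lookup e x * variable_weight x)"

lemma weight_add: "weight (e + e') = weight e + weight e'"
  by (simp add: weight_def lookup_add sum.distrib distrib_right)

lemma weight_single [simp]: "weight (Poly_Mapping.single x m) = m * variable_weight x"
  by (simp add: weight_def lookup_single when_def if_distrib[of "\<lambda>y. y * _"] sum.delta' cong: if_cong)

definition above :: "nat \<Rightarrow> 'n hpoly set" where
  "above m = {f. \<forall>k\<in>Poly_Mapping.keys f. m < weight k}"

text \<open>Leading means lightest: all remaining monomials are strictly heavier, and ties among
  those are allowed.\<close>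

definition lead :: "'n hpoly \<Rightarrow> (('n \<times> 4) \<Rightarrow>\<^sub>0 nat) \<Rightarrow> quat \<Rightarrow> bool" where
  "lead f e c \<longleftrightarrow> c \<noteq> 0 \<and> f - Poly_Mapping.single e c \<in> above (weight e)"

lemma above_add: "f \<in> above m \<Longrightarrow> g \<in> above m \<Longrightarrow> f + g \<in> above m"
  using Poly_Mapping.keys_add[of f g] unfolding above_def by blast

lemma above_single: "m < weight k \<Longrightarrow> Poly_Mapping.single k c \<in> above m"
  by (simp add: above_def)

lemma above_mult:
  assumes "\<forall>k\<in>Poly_Mapping.keys f. m \<le> weight k" "g \<in> above m'"
  shows "f * g \<in> above (m + m')" "g * f \<in> above (m + m')"
proof -
  show "f * g \<in> above (m + m')"
    using assms keys_mult[of f g] unfolding above_def by (fastforce simp: weight_add intro: add_le_less_mono)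
  show "g * f \<in> above (m + m')"
    using assms keys_mult[of g f] unfolding above_def
    by (fastforce simp: weight_add add.commute[of m] intro: add_less_le_mono)
qed

text \<open>The leading coefficient of the product is nonzero because quaternions have no zero
  divisors.\<close>

lemma lead_mult:
  assumes "lead f e c" "lead g e' c'"
  shows "lead (f * g) (e + e') (c * c')"
proof -
  define f' where "f' = f - Poly_Mapping.single e c"
  define g' where "g' = g - Poly_Mapping.single e' c'"
  have f': "f' \<in> above (weight e)" and g': "g' \<in> above (weight e')" and "c \<noteq> 0" "c' \<noteq> 0"
    using assms by (auto simp: lead_def f'_def g'_def)
  have f: "f = Poly_Mapping.single e c + f'" and g: "g = Poly_Mapping.single e' c' + g'"
    by (simp_all add: f'_def g'_def)
  have "Poly_Mapping.keys g \<subseteq> insert e' (Poly_Mapping.keys g')"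
    unfolding g using Poly_Mapping.keys_add[of "Poly_Mapping.single e' c'" g'] by (auto split: if_splits)
  then have "\<forall>k\<in>Poly_Mapping.keys g. weight e' \<le> weight k"
    using g' by (fastforce simp: above_def)
  then have "f' * g \<in> above (weight (e + e'))"
    using f' above_mult(2)[of g "weight e'" f' "weight e"] by (simp add: weight_add add.commute)
  moreover have "Poly_Mapping.single e c * g' \<in> above (weight (e + e'))"
    using g' above_mult(1)[of "Poly_Mapping.single e c" "weight e" g' "weight e'"] by (simp add: weight_add)
  moreover have "f * g - Poly_Mapping.single (e + e') (c * c') = Poly_Mapping.single e c * g' + f' * g"
    unfolding f by (simp add: distrib_right) (simp add: g distrib_left mult_single)
  ultimately show ?thesis using \<open>c \<noteq> 0\<close> \<open>c' \<noteq> 0\<close> by (simp add: lead_def above_add)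
qed

lemma lead_single: "c \<noteq> 0 \<Longrightarrow> lead (Poly_Mapping.single e c) e c"
  by (simp add: lead_def above_def)

lemma lead_one: "lead 1 0 1"
  using lead_single[of 1 0] by simp

lemma lead_lookup:
  assumes "lead f e c"
  shows "Poly_Mapping.lookup f e = c" "k \<noteq> e \<Longrightarrow> weight k \<le> weight e \<Longrightarrow> Poly_Mapping.lookup f k = 0"
proof -
  have *: "Poly_Mapping.lookup (f - Poly_Mapping.single e c) k = 0" if "weight k \<le> weight e" for k
    using assms that unfolding lead_def above_def by (metis (mono_tags, lifting) in_keys_iff leD mem_Collect_eq)
  show "Poly_Mapping.lookup f e = c" using *[of e] by (simp add: lookup_minus)
  show "k \<noteq> e \<Longrightarrow> weight k \<le> weight e \<Longrightarrow> Poly_Mapping.lookup f k = 0"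
    using *[of k] by (simp add: lookup_minus lookup_single)
qed

lemma lead_prod_list:
  assumes "\<And>x. x \<in> set xs \<Longrightarrow> \<exists>c. lead (f x) (e x) c"
  shows "\<exists>c. lead (prod_list (map f xs)) (sum_list (map e xs)) c"
  using assms
proof (induction xs)
  case Nil
  then show ?case using lead_one by auto
next
  case (Cons x xs)
  then obtain c c' where "lead (f x) (e x) c" "lead (prod_list (map f xs)) (sum_list (map e xs)) c'"
    by force
  then have "lead (prod_list (map f (x # xs))) (sum_list (map e (x # xs))) (c * c')"
    by (simp add: lead_mult)
  then show ?case ..
qed

end

section \<open>Evaluation of columns in quaternionic polynomials\<close>

definition vpoly :: "'n \<Rightarrow> 'n hpoly" where
  "vpoly i = Poly_Mapping.single (xexp i 2) (Quat 0 2 0 0) + Poly_Mapping.single (xexp i 3) (Quat 0 0 2 0)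
     + Poly_Mapping.single (xexp i 4) (Quat 0 0 0 2)"

lemma commutator_single:
  "commutator (Poly_Mapping.single p x) (Poly_Mapping.single r y :: 'n hpoly)
     = Poly_Mapping.single (p + r) (commutator x y)"
  by (simp add: commutator_def mult_single add.commute[of r] flip: single_diff)

lemma commutator_add:
  "commutator (a + b) c = commutator a c + commutator b c"
  "commutator c (a + b) = commutator c a + commutator c b" for a b c :: "'a::ring"
  by (simp_all add: commutator_def algebra_simps)

lemma commutator_vpoly:
  "commutator (vpoly a) (vpoly b) =
     Poly_Mapping.single (xexp a 2 + xexp b 3) (Quat 0 0 0 8)
   + Poly_Mapping.single (xexp a 3 + xexp b 2) (Quat 0 0 0 (- 8))
   + Poly_Mapping.single (xexp a 2 + xexp b 4) (Quat 0 0 (- 8) 0)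
   + Poly_Mapping.single (xexp a 4 + xexp b 2) (Quat 0 0 8 0)
   + Poly_Mapping.single (xexp a 3 + xexp b 4) (Quat 0 8 0 0)
   + Poly_Mapping.single (xexp a 4 + xexp b 3) (Quat 0 (- 8) 0 0)"
  unfolding vpoly_def commutator_add commutator_single
  by (simp add: commutator_def[of "Quat _ _ _ _"] quat_defs) (simp add: algebra_simps flip: zero_quat_def)

lemma anticomm_single:
  "anticomm (Poly_Mapping.single p x) (Poly_Mapping.single r y :: 'n hpoly)
     = Poly_Mapping.single (p + r) (anticomm x y)"
  by (simp add: anticomm_def mult_single add.commute[of r] flip: single_add)

lemma anticomm_add:
  "anticomm (a + b) c = anticomm a c + anticomm b c"
  "anticomm c (a + b) = anticomm c a + anticomm c b" for a b c :: "'a::ring"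
  by (simp_all add: anticomm_def algebra_simps)

text \<open>This is -4 times the determinant of three vectors each carrying a factor 2, hence the
  coefficients 32 and -32.\<close>

lemma triple_vpoly:
  "triple (vpoly a) (vpoly b) (vpoly c) =
     Poly_Mapping.single (xexp a 2 + (xexp b 3 + xexp c 4)) (Quat (- 32) 0 0 0)
   + Poly_Mapping.single (xexp a 2 + (xexp b 4 + xexp c 3)) (Quat 32 0 0 0)
   + Poly_Mapping.single (xexp a 3 + (xexp b 2 + xexp c 4)) (Quat 32 0 0 0)
   + Poly_Mapping.single (xexp a 3 + (xexp b 4 + xexp c 2)) (Quat (- 32) 0 0 0)
   + Poly_Mapping.single (xexp a 4 + (xexp b 2 + xexp c 3)) (Quat (- 32) 0 0 0)
   + Poly_Mapping.single (xexp a 4 + (xexp b 3 + xexp c 2)) (Quat 32 0 0 0)"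
  unfolding triple_def commutator_vpoly unfolding vpoly_def anticomm_add anticomm_single
  by (simp add: anticomm_def[of "Quat _ _ _ _"] quat_defs) (simp add: algebra_simps flip: zero_quat_def)

section \<open>Standard monomials\<close>

lemma sorted_eq_of_counts:
  fixes xs ys :: "nat list"
  assumes "sorted xs" "sorted ys" "set xs \<subseteq> {..<n}" "set ys \<subseteq> {..<n}"
    and "\<And>i. i < n \<Longrightarrow> count_list xs i = count_list ys i"
  shows "xs = ys"
proof -
  have "count_list xs i = count_list ys i" for i
  proof (cases "i < n")
    case False
    then have "i \<notin> set xs" "i \<notin> set ys" using assms(3,4) by auto
    then show ?thesis by simp
  qed (rule assms(5))
  then have "mset xs = mset ys" by (intro multiset_eqI) (simp add: count_mset)
  then show ?thesis using assms(1,2) by (metis properties_for_sort)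
qed

lemma sorted_split_top:
  fixes xs :: "nat list"
  assumes "sorted xs" "set xs \<subseteq> {..<n} \<union> {N}" "n \<le> N"
  shows "xs = filter (\<lambda>x. x < n) xs @ replicate (length xs - length (filter (\<lambda>x. x < n) xs)) N"
  using assms
proof (induction xs)
  case (Cons x xs)
  show ?case
  proof (cases "x < n")
    case True
    then show ?thesis using Cons by simp
  next
    case False
    then have "x = N" and "\<forall>y\<in>set xs. y = N" using Cons.prems by force+
    then have "xs = replicate (length xs) N" and "filter (\<lambda>x. x < n) xs = []"
      using Cons.prems(3) by (auto simp: replicate_length_same filter_empty_conv)
    then show ?thesis using \<open>x = N\<close> False by simp
  qed
qed simp

text \<open>Exponents do not record the padding \<open>N\<close>; the common length supplies how
  often it occurs at the end of the row.\<close>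

lemma sorted_top_eq_of_counts:
  fixes xs ys :: "nat list"
  assumes "sorted xs" "sorted ys" "set xs \<subseteq> {..<n} \<union> {N}" "set ys \<subseteq> {..<n} \<union> {N}" "n \<le> N"
    and "length xs = length ys"
    and "\<And>i. i < n \<Longrightarrow> count_list xs i = count_list ys i"
  shows "xs = ys"
proof -
  have c: "count_list (filter (\<lambda>x. x < n) zs) i = count_list zs i" if "i < n" for zs :: "nat list" and i
    using that by (induction zs) auto
  have "filter (\<lambda>x. x < n) xs = filter (\<lambda>x. x < n) ys"
    by (rule sorted_eq_of_counts[of _ _ n]) (use assms in \<open>auto simp: sorted_wrt_filter c\<close>)
  then show ?thesis
    using sorted_split_top[OF assms(1,3,5)] sorted_split_top[OF assms(2,4,5)] assms(6) by metis
qed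

locale enumeration =
  fixes \<phi> :: "nat \<Rightarrow> 'n::finite" and n :: nat
  assumes bij_\<phi>: "bij_betw \<phi> {..<n} UNIV"
begin

definition rk :: "'n \<Rightarrow> nat" where "rk = inv_into {..<n} \<phi>"

lemma rk_\<phi>: "a < n \<Longrightarrow> rk (\<phi> a) = a"
  unfolding rk_def using bij_\<phi> by (simp add: bij_betw_def)

lemma \<phi>_eq_iff: "a < n \<Longrightarrow> b < n \<Longrightarrow> \<phi> a = \<phi> b \<longleftrightarrow> a = b"
  using rk_\<phi> by metis

lemma \<phi>_surj: "\<exists>a<n. i = \<phi> a"
  using bij_\<phi> unfolding bij_betw_def by (metis UNIV_I imageE lessThan_iff)

text \<open>
  Least weight makes the diagonal term the leading one of a column \<open>a < b < c\<close>: the factors in the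
  third and fourth coordinate are cheapest for large indices.
\<close>

definition variable_weight :: "'n \<times> 4 \<Rightarrow> nat" where
  "variable_weight x = (if snd x = 3 then 3 * n - rk (fst x) else if snd x = 4 then 2 * (3 * n - rk (fst x)) else 0)"

lemma variable_weight_simps:
  "variable_weight (i, 1) = 0" "variable_weight (i, 2) = 0"
  "a < n \<Longrightarrow> variable_weight (\<phi> a, 3) = 3 * n - a" "a < n \<Longrightarrow> variable_weight (\<phi> a, 4) = 2 * (3 * n - a)"
  by (simp_all add: variable_weight_def rk_\<phi>)

definition vec :: "nat \<Rightarrow> 'n qalg" where
  "vec a = qalg_letter (Q (\<phi> a)) - qalg_letter (Qbar (\<phi> a))"

definition trc :: "nat \<Rightarrow> 'n qalg" where
  "trc a = qalg_letter (Q (\<phi> a)) + qalg_letter (Qbar (\<phi> a))"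

end

sublocale enumeration \<subseteq> graded_exponents variable_weight .

sublocale enumeration \<subseteq> skew_columns_traces qalg_star vec n trc
proof -
  interpret central_trace "qalg_star :: 'n qalg \<Rightarrow> 'n qalg" by (rule central_trace_qalg_star)
  show "skew_columns_traces qalg_star vec trc"
  proof
    show "skew (vec i)" for i
      by (simp add: skew_def vec_def st_diff qalg_star_letter)
    show "trc i * x = x * trc i" for i x
      using trace_central[of "qalg_letter (Q (\<phi> i))" x] by (simp add: trc_def qalg_star_letter)
  qed
qed

lemma qalg_rho_letter: "qalg_rho (qalg_letter l) = rho_letter l"
  by (simp add: qalg_letter_def qalg_rho.abs_eq word_poly_def hconst_simps)

context enumeration
begin

lemma rho_vec: "qalg_rho (vec a) = vpoly (\<phi> a)"
proof -
  have "rho_letter (Q i) - rho_letter (Qbar i) = vpoly i" for i :: 'n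
    unfolding rho_letter_Qbar
    by (simp add: vpoly_def xvar_def hconst_def mult_single quat_i_def quat_j_def quat_k_def quat_defs
        algebra_simps flip: single_add)
  then show ?thesis by (simp add: vec_def qalg_rho_simps qalg_rho_letter del: rho_letter.simps)
qed

lemma rho_trc: "qalg_rho (trc a) = Poly_Mapping.single (xexp (\<phi> a) 1) (Quat 2 0 0 0)"
proof -
  have "rho_letter (Q i) + rho_letter (Qbar i) = Poly_Mapping.single (xexp i 1) (Quat 2 0 0 0)" for i :: 'n
    unfolding rho_letter_Qbar
    by (simp add: xvar_def quat_defs flip: single_add)
  then show ?thesis by (simp add: trc_def qalg_rho_simps qalg_rho_letter del: rho_letter.simps)
qed

lemma rho_commutator: "qalg_rho (commutator x y) = commutator (qalg_rho x) (qalg_rho y)"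
  by (simp add: commutator_def qalg_rho_simps)

lemma rho_triple: "qalg_rho (triple x y z) = triple (qalg_rho x) (qalg_rho y) (qalg_rho z)"
  by (simp add: triple_def anticomm_def rho_commutator qalg_rho_simps)

fun column_exp :: "nat \<times> nat \<times> nat \<Rightarrow> ('n \<times> 4) \<Rightarrow>\<^sub>0 nat" where
  "column_exp (a, b, c) = (if a < n then xexp (\<phi> a) 2 else 0) + (if b < n then xexp (\<phi> b) 3 else 0)
     + (if c < n then xexp (\<phi> c) 4 else 0)"

text \<open>The second coordinate costs nothing and the fourth index factor counts double. As 3n - x
  decreases in x, assigning coordinates 2, 3, 4 to increasing indices is the strictly cheapest
  choice; shorter columns omit the expensive coordinates.\<close>

lemma lead_column:
  assumes "valid C"
  shows "\<exists>c. lead (qalg_rho (column C)) (column_exp C) c"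
  using assms
proof (cases rule: valid_cases)
  case empty
  then show ?thesis using lead_one by (auto simp: qalg_rho_simps)
next
  case (one a)
  then have "lead (vpoly (\<phi> a)) (xexp (\<phi> a) 2) (Quat 0 2 0 0)"
    by (auto simp: lead_def vpoly_def zero_quat_def variable_weight_simps intro!: above_add above_single)
  then show ?thesis using one by (auto simp: rho_vec)
next
  case (two a b)
  then have "lead (commutator (vpoly (\<phi> a)) (vpoly (\<phi> b))) (xexp (\<phi> a) 2 + xexp (\<phi> b) 3) (Quat 0 0 0 8)"
    by (auto simp: lead_def commutator_vpoly zero_quat_def variable_weight_simps weight_add intro!: above_add above_single)
  then show ?thesis using two by (auto simp: rho_vec rho_commutator)
next
  case (three a b c)
  then have "lead (triple (vpoly (\<phi> a)) (vpoly (\<phi> b)) (vpoly (\<phi> c)))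
      (xexp (\<phi> a) 2 + (xexp (\<phi> b) 3 + xexp (\<phi> c) 4)) (Quat (- 32) 0 0 0)"
    by (auto simp: lead_def triple_vpoly zero_quat_def variable_weight_simps weight_add intro!: above_add above_single)
  then show ?thesis using three by (auto simp: rho_vec rho_triple add.assoc)
qed

definition monomial_exp :: "nat list \<Rightarrow> (nat \<times> nat \<times> nat) list \<Rightarrow> ('n \<times> 4) \<Rightarrow>\<^sub>0 nat" where
  "monomial_exp us T = sum_list (map (\<lambda>a. xexp (\<phi> a) 1) us) + sum_list (map column_exp T)"

lemma rho_prod_list: "qalg_rho (prod_list xs) = prod_list (map qalg_rho xs)"
  by (induction xs) (simp_all add: qalg_rho_simps)

lemma lead_monomial:
  assumes "proper T"
  shows "\<exists>c. lead (qalg_rho (monomial us T)) (monomial_exp us T) c"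
proof -
  have "\<exists>c. lead (prod_list (map (\<lambda>a. qalg_rho (trc a)) us)) (sum_list (map (\<lambda>a. xexp (\<phi> a) 1) us)) c"
    by (rule lead_prod_list) (auto simp: rho_trc zero_quat_def intro!: lead_single exI)
  moreover have "\<exists>c. lead (prod_list (map (\<lambda>C. qalg_rho (column C)) T)) (sum_list (map column_exp T)) c"
    by (rule lead_prod_list) (use assms lead_column in \<open>auto simp: proper_def simp del: valid.simps\<close>)
  ultimately show ?thesis
    unfolding monomial_def monomial_exp_def by (auto simp: qalg_rho_simps rho_prod_list comp_def dest: lead_mult)
qed

lemma lookup_monomial_exp:
  assumes "i < n" "set us \<subseteq> {..<n}"
  shows "Poly_Mapping.lookup (monomial_exp us T) (\<phi> i, 1) = count_list us i"
    "Poly_Mapping.lookup (monomial_exp us T) (\<phi> i, 2) = count_list (map fst T) i"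
    "Poly_Mapping.lookup (monomial_exp us T) (\<phi> i, 3) = count_list (map (fst \<circ> snd) T) i"
    "Poly_Mapping.lookup (monomial_exp us T) (\<phi> i, 4) = count_list (map (snd \<circ> snd) T) i"
proof -
  have C: "Poly_Mapping.lookup (column_exp (a, b, c)) (\<phi> i, j) =
      (if j = 2 \<and> a = i then 1 else 0) + (if j = 3 \<and> b = i then 1 else 0) + (if j = 4 \<and> c = i then 1 else 0)"
    for a b c j
    using assms(1) by (auto simp: lookup_add lookup_single when_def \<phi>_eq_iff)
  have T: "Poly_Mapping.lookup (sum_list (map column_exp T)) (\<phi> i, 1) = 0"
    "Poly_Mapping.lookup (sum_list (map column_exp T)) (\<phi> i, 2) = count_list (map fst T) i"
    "Poly_Mapping.lookup (sum_list (map column_exp T)) (\<phi> i, 3) = count_list (map (fst \<circ> snd) T) i"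
    "Poly_Mapping.lookup (sum_list (map column_exp T)) (\<phi> i, 4) = count_list (map (snd \<circ> snd) T) i"
    by (induction T; force simp: lookup_add C simp del: column_exp.simps)+
  have U: "Poly_Mapping.lookup (sum_list (map (\<lambda>a. xexp (\<phi> a) 1) us)) (\<phi> i, j) =
      (if j = 1 then count_list us i else 0)" for j
    using assms by (induction us) (auto simp: lookup_add lookup_single when_def \<phi>_eq_iff)
  show "Poly_Mapping.lookup (monomial_exp us T) (\<phi> i, 1) = count_list us i"
    "Poly_Mapping.lookup (monomial_exp us T) (\<phi> i, 2) = count_list (map fst T) i"
    "Poly_Mapping.lookup (monomial_exp us T) (\<phi> i, 3) = count_list (map (fst \<circ> snd) T) i"
    "Poly_Mapping.lookup (monomial_exp us T) (\<phi> i, 4) = count_list (map (snd \<circ> snd) T) i"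
    unfolding monomial_exp_def lookup_add T U by simp_all
qed

lemma proper_rows:
  assumes "proper T"
  shows "sorted (map fst T)" "sorted (map (fst \<circ> snd) T)" "sorted (map (snd \<circ> snd) T)"
    "set (map fst T) \<subseteq> {..<n}" "set (map (fst \<circ> snd) T) \<subseteq> {..<n} \<union> {3 * n}"
    "set (map (snd \<circ> snd) T) \<subseteq> {..<n} \<union> {3 * n}"
proof -
  have "sorted_wrt column_le T" using assms by (simp add: proper_def)
  then show "sorted (map fst T)" "sorted (map (fst \<circ> snd) T)" "sorted (map (snd \<circ> snd) T)"
    unfolding sorted_map by (elim sorted_wrt_mono_rel[rotated]; auto)+
  have "valid C \<and> C \<noteq> (3 * n, 3 * n, 3 * n)" if "C \<in> set T" for C using that assms by (simp add: proper_def)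
  then have "fst C < n \<and> fst (snd C) \<in> {..<n} \<union> {3 * n} \<and> snd (snd C) \<in> {..<n} \<union> {3 * n}" if "C \<in> set T" for C
    using that by (cases C) fastforce
  then show "set (map fst T) \<subseteq> {..<n}" "set (map (fst \<circ> snd) T) \<subseteq> {..<n} \<union> {3 * n}"
    "set (map (snd \<circ> snd) T) \<subseteq> {..<n} \<union> {3 * n}"
    by auto
qed

text \<open>The first row has no padding, so it yields the number of columns. With that length the
  two padded rows are determined by their counts.\<close>

lemma monomial_exp_inj:
  assumes "proper T" "proper T'" "sorted us" "sorted us'" "set us \<subseteq> {..<n}" "set us' \<subseteq> {..<n}"
    and eq: "monomial_exp us T = monomial_exp us' T'"
  shows "us = us' \<and> T = T'"
proof -
  note l = lookup_monomial_exp[OF _ assms(5), of _ T] lookup_monomial_exp[OF _ assms(6), of _ T']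
  have "us = us'" by (rule sorted_eq_of_counts[of _ _ n]) (use assms l in \<open>simp_all add: eq\<close>)
  moreover have 1: "map fst T = map fst T'"
    by (rule sorted_eq_of_counts[of _ _ n]) (use assms(1,2) proper_rows l in \<open>simp_all add: eq\<close>)
  then have len: "length T = length T'" by (metis length_map)
  moreover have 2: "map (fst \<circ> snd) T = map (fst \<circ> snd) T'"
    by (rule sorted_top_eq_of_counts[of _ _ n "3 * n"]) (use assms(1,2) proper_rows l len in \<open>simp_all add: eq\<close>)
  moreover have 3: "map (snd \<circ> snd) T = map (snd \<circ> snd) T'"
    by (rule sorted_top_eq_of_counts[of _ _ n "3 * n"]) (use assms(1,2) proper_rows l len in \<open>simp_all add: eq\<close>)
  moreover have "T = T'"
    using len 1 2 3 by (induction T T' rule: list_induct2) (auto simp: prod_eq_iff)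
  ultimately show ?thesis by simp
qed

section \<open>Spanning and linear independence of the standard monomials\<close>

lemma span_standard: "(x :: 'n qalg) \<in> span standard_monomials"
proof (induction x rule: qalg_induct)
  case one
  show ?case by (intro span_base one_standard)
next
  case (letter l x)
  obtain a where a: "a < n" "idx l = \<phi> a" using \<phi>_surj by blast
  have tv: "trc a * x \<in> span standard_monomials" "vec a * x \<in> span standard_monomials"
    using span_standard_t span_standard_v a(1) letter by blast+
  have half: "(1/2) *\<^sub>R (x + x) = x" for x :: "'n qalg"
    by (simp flip: scaleR_2)
  \<comment> \<open>Left multiplication by letters reduces to the closure under \<open>trc a\<close>
    and \<open>vec a\<close>; this halving uses real scalars.\<close>
  have "qalg_letter (Q (\<phi> a)) = (1/2) *\<^sub>R (trc a + vec a)"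
      "qalg_letter (Qbar (\<phi> a)) = (1/2) *\<^sub>R (trc a - vec a)"
    by (simp_all add: trc_def vec_def half)
  then have "qalg_letter l * x = (1/2) *\<^sub>R (trc a * x + vec a * x) \<or>
      qalg_letter l * x = (1/2) *\<^sub>R (trc a * x - vec a * x)"
    using a(2) by (cases l) (simp_all add: distrib_right left_diff_distrib)
  then show ?case using tv span_scale span_add span_diff by metis
qed (simp_all add: span_add span_scale)

text \<open>A standard monomial is an element of the algebra and could a priori arise from several
  pairs of trace list and tableau, so one pair is chosen. Exponents determine the pair, which makes
  \<open>E\<close> injective for any choice.\<close>

lemma lead_standard:
  obtains E where "\<And>x. x \<in> standard_monomials \<Longrightarrow> \<exists>c. lead (qalg_rho x) (E x) c" "inj_on E standard_monomials"
proof -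
  define P where "P x uT \<longleftrightarrow> (case uT of (us, T) \<Rightarrow>
    x = monomial us T \<and> sorted us \<and> set us \<subseteq> {..<n} \<and> proper T)" for x uT
  define E where "E x = (case (SOME uT. P x uT) of (us, T) \<Rightarrow> monomial_exp us T)" for x
  have P: "P x (SOME uT. P x uT)" if "x \<in> standard_monomials" for x
  proof (rule someI_ex)
    show "\<exists>uT. P x uT" using that by (auto simp: standard_monomials_def P_def)
  qed
  have "\<exists>c. lead (qalg_rho x) (E x) c" if "x \<in> standard_monomials" for x
    using P[OF that] lead_monomial unfolding P_def E_def by (auto split: prod.splits)
  moreover have "inj_on E standard_monomials"
  proof (rule inj_onI)
    fix x y assume xy: "x \<in> standard_monomials" "y \<in> standard_monomials" "E x = E y"
    obtain us T us' T' where s: "(SOME uT. P x uT) = (us, T)" "(SOME uT. P y uT) = (us', T')"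
      by (metis surj_pair)
    then have "P x (us, T)" "P y (us', T')" using P xy by metis+
    moreover have "monomial_exp us T = monomial_exp us' T'" using xy(3) by (simp add: E_def s)
    ultimately have "us = us' \<and> T = T'" unfolding P_def by (intro monomial_exp_inj) simp_all
    then show "x = y" using \<open>P x (us, T)\<close> \<open>P y (us', T')\<close> by (simp add: P_def)
  qed
  ultimately show thesis by (rule that)
qed

lemma qalg_rho_sum: "qalg_rho (sum f S) = (\<Sum>x\<in>S. qalg_rho (f x))"
  by (induction S rule: infinite_finite_induct) (simp_all add: qalg_rho_simps)

lemma lookup_hpoly_sum:
  "Poly_Mapping.lookup (sum f S) k = (\<Sum>x\<in>S. Poly_Mapping.lookup (f x) k)"
  by (induction S rule: infinite_finite_induct) (simp_all add: lookup_add)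

lemma qalg_rho_eq_0_imp:
  fixes x :: "'n qalg"
  assumes "qalg_rho x = 0"
  shows "x = 0"
proof -
  obtain E where E: "\<And>x. x \<in> standard_monomials \<Longrightarrow> \<exists>c. lead (qalg_rho x) (E x) c" "inj_on E standard_monomials"
    using lead_standard by blast
  obtain S r where S: "finite S" "S \<subseteq> standard_monomials" "x = (\<Sum>a\<in>S. r a *\<^sub>R a)"
    using span_standard[of x] unfolding span_explicit by blast
  \<comment> \<open>Vanishing coefficients are removed so that the lightest term found below really
    occurs.\<close>
  define S' where "S' = {a \<in> S. r a \<noteq> 0}"
  have S': "finite S'" "S' \<subseteq> standard_monomials" "\<And>a. a \<in> S' \<Longrightarrow> r a \<noteq> 0" using S by (auto simp: S'_def)
  have x: "x = (\<Sum>a\<in>S'. r a *\<^sub>R a)"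
    unfolding S(3) S'_def using S(1) by (intro sum.mono_neutral_right) auto
  have "S' = {}"
  proof (rule ccontr)
    assume "S' \<noteq> {}"
    then obtain m where m: "m \<in> S'" "\<And>a. a \<in> S' \<Longrightarrow> weight (E m) \<le> weight (E a)"
      using ex_min_if_finite[of "(\<lambda>a. weight (E a)) ` S'"] S'(1)
      by (metis (no_types, lifting) arg_min_if_finite(1) arg_min_least)
    obtain c where c: "lead (qalg_rho m) (E m) c" using E(1) m(1) S'(2) by blast
    \<comment> \<open>The leading exponent of any other term differs from \<open>E m\<close> and is
      not lighter, so nothing can cancel the coefficient at \<open>E m\<close>.\<close>
    have "Poly_Mapping.lookup (qalg_rho a) (E m) = 0" if a: "a \<in> S'" "a \<noteq> m" for a
    proof -
      obtain d where "lead (qalg_rho a) (E a) d" using E(1) a S'(2) by blast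
      moreover have "E m \<noteq> E a" using E(2) a m(1) S'(2) unfolding inj_on_def by blast
      ultimately show ?thesis using lead_lookup(2) m(2) a by blast
    qed
    then have "(\<Sum>a\<in>S'. quat_of_real (r a) * Poly_Mapping.lookup (qalg_rho a) (E m))
        = (\<Sum>a\<in>S'. if a = m then quat_of_real (r m) * c else 0)"
      using lead_lookup(1)[OF c] by (intro sum.cong) auto
    then have "Poly_Mapping.lookup (qalg_rho x) (E m) = quat_of_real (r m) * c"
      using S'(1) m(1) by (simp add: x qalg_rho_sum lookup_hpoly_sum qalg_rho_simps lookup_hconst_mult)
    moreover have "quat_of_real (r m) \<noteq> 0" using S'(3)[OF m(1)] by (simp add: quat_of_real_def zero_quat_def)
    ultimately show False using assms c by (simp add: lead_def)
  qed
  then show ?thesis by (simp add: x)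
qed

end

text \<open>Columns need a linear order on the indices; an arbitrary enumeration of the finite index
  type provides it.\<close>

lemma qalg_rho_injective:
  fixes x :: "'n::finite qalg"
  assumes "qalg_rho x = 0"
  shows "x = 0"
proof -
  obtain \<phi> :: "nat \<Rightarrow> 'n" where "bij_betw \<phi> {..<card (UNIV :: 'n set)} UNIV"
    using ex_bij_betw_nat_finite[of "UNIV :: 'n set"] by (auto simp: atLeast0LessThan)
  then interpret enumeration \<phi> "card (UNIV :: 'n set)" by unfold_locales
  show ?thesis using assms by (rule qalg_rho_eq_0_imp)
qed

theorem lemma4p4:
  "(real_identity_ideal :: 'n::finite qpoly set) =
     star_ideal_generated
       {commutator (word_poly w + star (word_poly w)) (q i) | (w :: 'n qword) (i :: 'n). True}"
  unfolding real_identity_ideal_def trace_ideal_def[symmetric]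
proof
  show "trace_ideal \<subseteq> {p :: 'n qpoly. rho p = 0}" by (rule trace_ideal_subset_kernel)
  show "{p :: 'n qpoly. rho p = 0} \<subseteq> trace_ideal"
  proof
    fix p :: "'n qpoly" assume "p \<in> {p. rho p = 0}"
    then have "qalg_rho (qalg_of p) = 0" by (simp add: qalg_rho.abs_eq)
    then show "p \<in> trace_ideal" using qalg_rho_injective qalg_of_eq_0_iff by blast
  qed
qed

end
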